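(* For $j\in\{1,2\}$ let $U_j\subseteq\mathbb{R}^{n_j}$ be open and non-empty, let $\mathcal{D}_j\leq U_j\times \big(\mathbb{R}^{n_j+m_j^{\mathrm{r}}+m_j^{\mathrm{ep}}+m_j^{\mathrm{ip}}}\oplus\mathbb{R}^{n_j+m_j^{\mathrm{r}}+m_j^{\mathrm{ep}}+m_j^{\mathrm{ip}}}\big)$ be a constant Dirac structure, let $\mathcal{R}_j\leq U_j\times\big(\mathbb{R}^{m_j^\mathrm{r}}\oplus\mathbb{R}^{m_j^\mathrm{r}}\big)$ be a Lagrangian subbundle and let $H_j\in\mathcal{C}^\infty(U_j)$. Let $\mathcal{D}_{\mathrm{int}}\leq (U_1\times U_2)\times\big(\mathbb{R}^{m_1^{\mathrm{ip}}+m_2^{\mathrm{ip}}}\oplus\mathbb{R}^{m_1^{\mathrm{ip}}+m_2^{\mathrm{ip}}}\big)$ be a constant Dirac structure. Then, for $\mathfrak{t}\in\{\mathrm{c},\mathrm{w}\}$ and all real $t_0<t_1$, $$\big(\mathfrak{B}^{\mathfrak{t}}_{\mathcal{D}_1,\mathcal{R}_1,H_1}\Vert_{\mathcal{D}_{\mathrm{int}}}\mathfrak{B}^{\mathfrak{t}}_{\mathcal{D}_2,\mathcal{R}_2,H_2}\big)([t_0,t_1]) = \mathfrak{B}^{\mathfrak{t}}_{\mathcal{D}_1\Vert_{\mathcal{D}_{\mathrm{int}}}\mathcal{D}_2,\ \mathcal{R}_1\times\mathcal{R}_2,\ H_1+H_2}([t_0,t_1]).$$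
   Context: \textbf{Geometry.} $(\mathbb{R}^N)^*$ is identified with $\mathbb{R}^N$ by the Euclidean scalar product. On $\mathbb{R}^N\oplus\mathbb{R}^N$ consider $\langle\langle (f,e),(f',e')\rangle\rangle=\langle e',f\rangle+\langle e,f'\rangle$ and $\Omega((f,e),(f',e'))=\langle e',f\rangle-\langle e,f'\rangle$. For $U$ open in a Euclidean space, a Dirac structure (Lagrangian subbundle) in $U\times(\mathbb{R}^N\oplus\mathbb{R}^N)$ is a smooth subvector bundle of rank $N$ whose fibres are isotropic for $\langle\langle\cdot,\cdot\rangle\rangle$ (respectively $\Omega$). It is constant if it is of the form $U\times D$ for a fixed subspace $D\le\mathbb{R}^N\oplus\mathbb{R}^N$. $\mathcal{R}_1\times\mathcal{R}_2$ is the bundle over $U_1\times U_2$ of all $(f_1,f_2,e_1,e_2)$ with $(f_j,e_j)\in(\mathcal{R}_j)_{x_j}$. \textbf{Function spaces.} Let $I=[t_0,t_1]$. $\mathcal{C}^1(I,U)$ is the set of continuous curves $I\to U$ that extend to a $\mathcal{C}^1$ curve on an open interval containing $I$. $\mathcal{L}^1(I,\mathbb{R}^N)$ is the set of integrable measurable functions, and $(\mathcal{C}\cap W^{1,1})(I,U)$ the set of continuous $x:I\to U$ having a weak derivative $\tfrac{\mathrm{d}}{\mathrm{d}t}x\in\mathcal{L}^1(I,\mathbb{R}^n)$. \textbf{Weak sense.} Let $x:I\to U$ be continuous and $(f,e)\in\mathcal{L}^1(I,\mathbb{R}^N\oplus\mathbb{R}^N)$. For a Dirac structure $\mathcal{D}\le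 U\times(\mathbb{R}^N\oplus\mathbb{R}^N)$, $(f,e)\in\mathcal{D}_x$ in the weak sense means $\int_I\langle\varepsilon(t),f(t)\rangle+\langle e(t),\varphi(t)\rangle\,\mathrm{d}t=0$ for all continuous $(\varphi,\varepsilon):I\to\mathbb{R}^N\oplus\mathbb{R}^N$ with compact support in $(t_0,t_1)$ and $(\varphi(t),\varepsilon(t))\in\mathcal{D}_{x(t)}$ for all $t$. For a Lagrangian subbundle, the same with $+$ replaced by $-$. \textbf{Behaviours.} Let $U\subseteq\mathbb{R}^n$ be open, $\mathcal{D}\le U\times(\mathbb{R}^{n+m_r+m_p}\oplus\mathbb{R}^{n+m_r+m_p})$ a Dirac structure, $\mathcal{R}\le U\times(\mathbb{R}^{m_r}\oplus\mathbb{R}^{m_r})$ a Lagrangian subbundle and $H\in\mathcal{C}^\infty(U)$. Consider $$\big(\tfrac{\mathrm{d}}{\mathrm{d}t}x,f,-y,\nabla H(x),e,u\big)\in\mathcal{D}_x,\qquad(f,e)\in\mathcal{R}_x.\qquad( * )$$ Elements of behaviours are curves $(f,y,e,u)$ in the corresponding trivial bundle over $U$, so they include their base curve $x$ in $U$. $\mathfrak{B}^{\mathrm{c}}_{\mathcal{D},\mathcal{R},H}(I)$ is the set of continuous $(f,y,e,u)$ whose base curve $x$ is in $\mathcal{C}^1(I,U)$ and for which $( * )$ holds at every point. $\mathfrak{B}^{\mathrm{w}}_{\mathcal{D},\mathcal{R},H}(I)$ is the set of $\mathcal{L}^1$ curves $(f,y,e,u)$ whose base curve $x$ is in $(\mathcal{C}\cap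 W^{1,1})(I,U)$ and for which both relations of $( * )$ hold in the weak sense. \textbf{Interconnection.} In $\mathcal{D}_j$ the components are ordered as state ($\mathbb{R}^{n_j}$), resistive port ($\mathbb{R}^{m_j^{\mathrm r}}$), remaining external port ($\mathbb{R}^{m_j^{\mathrm{ep}}}$), interconnection port ($\mathbb{R}^{m_j^{\mathrm{ip}}}$), followed by the dual components in the same order; in $\mathfrak{B}^{\mathfrak{t}}_{\mathcal{D}_j,\mathcal{R}_j,H_j}$ the external port is $\mathbb{R}^{m_j^{\mathrm{ep}}+m_j^{\mathrm{ip}}}$. The fibre of $\mathcal{D}_1\Vert_{\mathcal{D}_{\mathrm{int}}}\mathcal{D}_2$ over $(x_1,x_2)\in U_1\times U_2$ is the set of all $(v_1,v_2,f_1,f_2,\eta_1,\eta_2,\alpha_1,\alpha_2,e_1,e_2,u_1,u_2)$ for which there is $(\zeta_1,\zeta_2,w_1,w_2)\in(\mathcal{D}_{\mathrm{int}})_{(x_1,x_2)}$ with $(v_j,f_j,\eta_j,\zeta_j,\alpha_j,e_j,u_j,w_j)\in(\mathcal{D}_j)_{x_j}$, $j=1,2$ (in the constant case this is again a constant Dirac structure). $\mathfrak{B}^{\mathfrak{t}}_{\mathcal{D}_1\Vert_{\mathcal{D}_{\mathrm{int}}}\mathcal{D}_2,\mathcal{R}_1\times\mathcal{R}_2,H_1+H_2}$ is the behaviour over $U_1\times U_2$ with external port $\mathbb{R}^{m_1^{\mathrm{ep}}+m_2^{\mathrm{ep}}}$ and Hamiltonian $(x_1,x_2)\mapsto H_1(x_1)+H_2(x_2)$.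 The behavioural interconnection $\big(\mathfrak{B}^{\mathfrak{t}}_{\mathcal{D}_1,\mathcal{R}_1,H_1}\Vert_{\mathcal{D}_{\mathrm{int}}}\mathfrak{B}^{\mathfrak{t}}_{\mathcal{D}_2,\mathcal{R}_2,H_2}\big)(I)$ is the set of curves $(f_1,f_2,y_1,y_2,e_1,e_2,u_1,u_2)$ (with base curve in $U_1\times U_2$) for which there exists a curve $(\overline{y}_1,\overline{y}_2,\overline{u}_1,\overline{u}_2):I\to\mathcal{D}_{\mathrm{int}}$ over the same base curve with $(f_j,y_j,-\overline{y}_j,e_j,u_j,\overline{u}_j)\in\mathfrak{B}^{\mathfrak{t}}_{\mathcal{D}_j,\mathcal{R}_j,H_j}(I)$ for $j=1,2$. *)

theory Defs
  imports "HOL-Analysis.Analysis"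
begin

section \<open>Finite-dimensional Euclidean spaces, dimension zero included\<close>

text \<open>
  The class \<^class>\<open>euclidean_space\<close> forces the dimension to be positive, but any of the port
  spaces $\mathbb{R}^m$ of a port-Hamiltonian system may be trivial.  The class below consists of all
  finite-dimensional real inner product spaces.  Completeness and second countability follow
  from the last axiom; they are superclasses because the Bochner integral asks for them.
  A type variable of this class stands for $\mathbb{R}^m$ with arbitrary $m \ge 0$, and a product
  type stands for $\mathbb{R}^{m+m'}$.
\<close>

class fd_inner = real_inner + banach + second_countable_topology +
  assumes finite_dim: "\<exists>B. finite B \<and> (\<forall>x. \<exists>c. x = (\<Sum>b\<in>B. c b *\<^sub>R b))"

lemma fd_inner_iff_span:
  "finite (B :: 'a::real_vector set) \<Longrightarrow> (\<forall>x. \<exists>c. x = (\<Sum>b\<in>B. c b *\<^sub>R b)) \<longleftrightarrow> span B = UNIV"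
  unfolding span_finite set_eq_iff by blast

lemma finite_span: "\<exists>B :: 'a::fd_inner set. finite B \<and> span B = UNIV"
proof -
  obtain B :: "'a set" where "finite B" "\<forall>x. \<exists>c. x = (\<Sum>b\<in>B. c b *\<^sub>R b)"
    using finite_dim by blast
  then show ?thesis
    using fd_inner_iff_span[of B] by blast
qed

instance euclidean_space \<subseteq> fd_inner
proof
  show "\<exists>B :: 'a set. finite B \<and> (\<forall>x. \<exists>c. x = (\<Sum>b\<in>B. c b *\<^sub>R b))"
    using fd_inner_iff_span[OF finite_Basis] by (intro exI[of _ Basis]) simp
qed

instance prod :: (fd_inner, fd_inner) fd_inner
proof
  obtain A :: "'a set" where A: "finite A" "span A = UNIV"
    using finite_span by blast
  obtain B :: "'b set" where B: "finite B" "span B = UNIV"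
    using finite_span by blast
  let ?C = "(\<lambda>a. (a, 0)) ` A \<union> (\<lambda>b. (0, b)) ` B"
  have l1: "linear (\<lambda>a::'a. (a, 0::'b))"
    by (rule linearI) auto
  have l2: "linear (\<lambda>b::'b. (0::'a, b))"
    by (rule linearI) auto
  have "z \<in> span ?C" for z :: "'a \<times> 'b"
  proof -
    have "(fst z, 0) \<in> span ((\<lambda>a. (a, 0::'b)) ` A)"
      using linear_span_image[OF l1, of A] A(2) by auto
    moreover have "(0, snd z) \<in> span ((\<lambda>b. (0::'a, b)) ` B)"
      using linear_span_image[OF l2, of B] B(2) by auto
    ultimately have "(fst z, 0) + (0, snd z) \<in> span ?C"
      by (meson span_add span_mono subsetD Un_upper1 Un_upper2)
    then show ?thesis
      by simp
  qed
  moreover have "finite ?C"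
    using A(1) B(1) by simp
  ultimately have fin: "finite ?C" and sp: "span ?C = UNIV"
    by blast+
  then show "\<exists>C :: ('a \<times> 'b) set. finite C \<and> (\<forall>x. \<exists>c. x = (\<Sum>b\<in>C. c b *\<^sub>R b))"
    using fd_inner_iff_span[OF fin] by (intro exI[of _ ?C]) simp
qed

text \<open>The space $\mathbb{R}^0$.\<close>

instantiation unit :: real_inner
begin

definition "(0 :: unit) = ()"
definition "(x :: unit) + y = ()"
definition "r *\<^sub>R (x :: unit) = ()"
definition "norm (x :: unit) = 0"
definition "dist (x :: unit) y = 0"
definition "sgn (x :: unit) = ()"
definition "inner (x :: unit) y = 0"
definition "(uniformity :: (unit \<times> unit) filter) = (INF e\<in>{0<..}. principal {(x, y). dist x y < e})"
definition "open (S :: unit set) \<longleftrightarrow> True"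

instance
  by standard (auto simp: zero_unit_def plus_unit_def scaleR_unit_def norm_unit_def dist_unit_def
    sgn_unit_def inner_unit_def uniformity_unit_def open_unit_def)

end

instance unit :: banach
proof
  fix X :: "nat \<Rightarrow> unit"
  have "X = (\<lambda>_. ())"
    by (rule ext) simp
  then show "convergent X"
    by (simp add: convergent_const)
qed

instance unit :: second_countable_topology
proof
  have "countable (UNIV :: unit set set)"
    by simp
  moreover have "open = generate_topology (UNIV :: unit set set)"
    by (auto simp: open_unit_def fun_eq_iff intro: generate_topology.Basis)
  ultimately show "\<exists>B :: unit set set. countable B \<and> open = generate_topology B"
    by blast
qed

instance unit :: fd_inner
  by standard (rule exI[of _ UNIV], simp)


section \<open>Smooth maps and smooth subbundles\<close>

primrec Ck_on :: "nat \<Rightarrow> 'a::real_normed_vector set \<Rightarrow> ('a \<Rightarrow> 'b::real_normed_vector) \<Rightarrow> bool" where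
  "Ck_on 0 S f \<longleftrightarrow> continuous_on S f"
| "Ck_on (Suc k) S f \<longleftrightarrow>
     (\<forall>x\<in>S. f differentiable (at x)) \<and> (\<forall>v. Ck_on k S (\<lambda>x. frechet_derivative f (at x) v))"

text \<open>Only meant for open \<open>S\<close> and a finite-dimensional domain.\<close>

definition smooth_on :: "'a::real_normed_vector set \<Rightarrow> ('a \<Rightarrow> 'b::real_normed_vector) \<Rightarrow> bool" where
  "smooth_on S f \<longleftrightarrow> (\<forall>k. Ck_on k S f)"

definition gradient :: "('a::real_inner \<Rightarrow> real) \<Rightarrow> 'a \<Rightarrow> 'a" where
  "gradient H x = (THE g. GDERIV H x :> g)"

text \<open>
  A family of fibres over \<open>U\<close> is a function \<open>E\<close> from points to sets; its values outside \<open>U\<close> are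
  irrelevant.  It is a smooth subbundle of rank \<open>k\<close> if it has smooth local frames of length \<open>k\<close>.
\<close>

definition smooth_subbundle ::
    "'a::fd_inner set \<Rightarrow> ('a \<Rightarrow> 'b::fd_inner set) \<Rightarrow> nat \<Rightarrow> bool" where
  "smooth_subbundle U E k \<longleftrightarrow>
     (\<forall>x\<in>U. \<exists>V s. open V \<and> x \<in> V \<and> V \<subseteq> U \<and>
        (\<forall>i<k. smooth_on V (s i)) \<and>
        (\<forall>y\<in>V. inj_on (\<lambda>i. s i y) {..<k} \<and> independent ((\<lambda>i. s i y) ` {..<k}) \<and>
                E y = span ((\<lambda>i. s i y) ` {..<k})))"

definition constant_bundle :: "'a set \<Rightarrow> ('a \<Rightarrow> 'b::real_vector set) \<Rightarrow> bool" where
  "constant_bundle U E \<longleftrightarrow> (\<exists>D. subspace D \<and> (\<forall>x\<in>U. E x = D))"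


section \<open>Dirac structures and Lagrangian subbundles\<close>

fun sym_pairing :: "'v::real_inner \<times> 'v \<Rightarrow> 'v \<times> 'v \<Rightarrow> real" where
  "sym_pairing (f, e) (f', e') = e' \<bullet> f + e \<bullet> f'"

fun symp_pairing :: "'v::real_inner \<times> 'v \<Rightarrow> 'v \<times> 'v \<Rightarrow> real" where
  "symp_pairing (f, e) (f', e') = e' \<bullet> f - e \<bullet> f'"

definition dirac_structure ::
    "'a::fd_inner set \<Rightarrow> ('a \<Rightarrow> ('v::fd_inner \<times> 'v) set) \<Rightarrow> bool" where
  "dirac_structure U D \<longleftrightarrow>
     smooth_subbundle U D (dim (UNIV :: 'v set)) \<and>
     (\<forall>x\<in>U. \<forall>p\<in>D x. \<forall>q\<in>D x. sym_pairing p q = 0)"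

definition lagrangian_subbundle ::
    "'a::fd_inner set \<Rightarrow> ('a \<Rightarrow> ('v::fd_inner \<times> 'v) set) \<Rightarrow> bool" where
  "lagrangian_subbundle U R \<longleftrightarrow>
     smooth_subbundle U R (dim (UNIV :: 'v set)) \<and>
     (\<forall>x\<in>U. \<forall>p\<in>R x. \<forall>q\<in>R x. symp_pairing p q = 0)"

definition prod_bundle ::
    "('a \<Rightarrow> ('v \<times> 'v) set) \<Rightarrow> ('b \<Rightarrow> ('w \<times> 'w) set) \<Rightarrow> 'a \<times> 'b \<Rightarrow> (('v \<times> 'w) \<times> ('v \<times> 'w)) set" where
  "prod_bundle R1 R2 = (\<lambda>(x1, x2).
     {((f1, f2), (e1, e2)) | f1 f2 e1 e2. (f1, e1) \<in> R1 x1 \<and> (f2, e2) \<in> R2 x2})"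


section \<open>Function spaces and the weak sense\<close>

text \<open>
  Curves on \<open>I = [t0, t1]\<close> are represented by total functions on \<^typ>\<open>real\<close>.  All conditions
  below depend only on the values on \<open>I\<close>, so every set of curves is the saturated set of
  all extensions of its members, and equality of such sets is equality of sets of curves on \<open>I\<close>.
\<close>

definition L1_curve :: "real \<Rightarrow> real \<Rightarrow> (real \<Rightarrow> 'a::fd_inner) \<Rightarrow> bool" where
  "L1_curve t0 t1 f \<longleftrightarrow> integrable (lebesgue_on {t0..t1}) f"

definition C1_curve :: "real \<Rightarrow> real \<Rightarrow> 'a set \<Rightarrow> (real \<Rightarrow> 'a::fd_inner) \<Rightarrow> bool" where
  "C1_curve t0 t1 U x \<longleftrightarrow>
     continuous_on {t0..t1} x \<and> x ` {t0..t1} \<subseteq> U \<and>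
     (\<exists>a b z. a < t0 \<and> t1 < b \<and> z C1_differentiable_on {a<..<b} \<and> (\<forall>t\<in>{t0..t1}. z t = x t))"

definition compact_support_in :: "real \<Rightarrow> real \<Rightarrow> (real \<Rightarrow> 'a::zero) \<Rightarrow> real set \<Rightarrow> bool" where
  "compact_support_in t0 t1 p I \<longleftrightarrow>
     (\<exists>K. compact K \<and> K \<subseteq> {t0<..<t1} \<and> (\<forall>t\<in>I - K. p t = 0))"

definition weak_derivative ::
    "real \<Rightarrow> real \<Rightarrow> (real \<Rightarrow> 'a::fd_inner) \<Rightarrow> (real \<Rightarrow> 'a) \<Rightarrow> bool" where
  "weak_derivative t0 t1 x v \<longleftrightarrow>
     L1_curve t0 t1 v \<and>
     (\<forall>\<phi> :: real \<Rightarrow> real. smooth_on UNIV \<phi> \<and> compact_support_in t0 t1 \<phi> UNIV \<longrightarrow>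
        (LINT t|lebesgue_on {t0..t1}. deriv \<phi> t *\<^sub>R x t) =
        - (LINT t|lebesgue_on {t0..t1}. \<phi> t *\<^sub>R v t))"

text \<open>
  The weak sense of \<open>c \<in> E\<^sub>x\<close>, where \<open>B\<close> is \<^const>\<open>sym_pairing\<close> for Dirac structures and
  \<^const>\<open>symp_pairing\<close> for Lagrangian subbundles: for \<open>c = (f, e)\<close> and a test curve
  \<open>p = (\<phi>, \<epsilon>)\<close> the integrand is \<open>\<epsilon> \<bullet> f + e \<bullet> \<phi>\<close>, respectively \<open>\<epsilon> \<bullet> f - e \<bullet> \<phi>\<close>.
\<close>

definition weakly_in ::
    "('v::fd_inner \<times> 'v \<Rightarrow> 'v \<times> 'v \<Rightarrow> real) \<Rightarrow> real \<Rightarrow> real \<Rightarrow>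
     ('a \<Rightarrow> ('v \<times> 'v) set) \<Rightarrow> (real \<Rightarrow> 'a) \<Rightarrow> (real \<Rightarrow> 'v \<times> 'v) \<Rightarrow> bool" where
  "weakly_in B t0 t1 E x c \<longleftrightarrow>
     (\<forall>p. continuous_on {t0..t1} p \<and> compact_support_in t0 t1 p {t0..t1} \<and>
          (\<forall>t\<in>{t0..t1}. p t \<in> E (x t)) \<longrightarrow>
          (LINT t|lebesgue_on {t0..t1}. B (c t) (p t)) = 0)"


section \<open>Behaviours\<close>

text \<open>
  A curve in the bundle is the tuple \<open>(x, f, y, e, u)\<close> of its base curve and its
  resistive flow, output, resistive effort and input.
\<close>

type_synonym ('n, 'r, 'p) curves =
  "((real \<Rightarrow> 'n) \<times> (real \<Rightarrow> 'r) \<times> (real \<Rightarrow> 'p) \<times> (real \<Rightarrow> 'r) \<times> (real \<Rightarrow> 'p)) set"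

definition classical_behaviour ::
    "'n::fd_inner set \<Rightarrow> ('n \<Rightarrow> (('n \<times> 'r::fd_inner \<times> 'p::fd_inner) \<times> ('n \<times> 'r \<times> 'p)) set) \<Rightarrow>
     ('n \<Rightarrow> ('r \<times> 'r) set) \<Rightarrow> ('n \<Rightarrow> real) \<Rightarrow> real \<Rightarrow> real \<Rightarrow> ('n, 'r, 'p) curves" where
  "classical_behaviour U D R H t0 t1 = {(x, f, y, e, u).
     C1_curve t0 t1 U x \<and>
     continuous_on {t0..t1} f \<and> continuous_on {t0..t1} y \<and>
     continuous_on {t0..t1} e \<and> continuous_on {t0..t1} u \<and>
     (\<forall>t\<in>{t0..t1}.
        ((vector_derivative x (at t within {t0..t1}), f t, - y t),
         (gradient H (x t), e t, u t)) \<in> D (x t) \<and>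
        (f t, e t) \<in> R (x t))}"

text \<open>
  The weak derivative \<open>v\<close> is unique up to null sets, on which the weak sense does not depend.
\<close>

definition weak_behaviour ::
    "'n::fd_inner set \<Rightarrow> ('n \<Rightarrow> (('n \<times> 'r::fd_inner \<times> 'p::fd_inner) \<times> ('n \<times> 'r \<times> 'p)) set) \<Rightarrow>
     ('n \<Rightarrow> ('r \<times> 'r) set) \<Rightarrow> ('n \<Rightarrow> real) \<Rightarrow> real \<Rightarrow> real \<Rightarrow> ('n, 'r, 'p) curves" where
  "weak_behaviour U D R H t0 t1 = {(x, f, y, e, u).
     continuous_on {t0..t1} x \<and> x ` {t0..t1} \<subseteq> U \<and>
     L1_curve t0 t1 f \<and> L1_curve t0 t1 y \<and> L1_curve t0 t1 e \<and> L1_curve t0 t1 u \<and>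
     (\<exists>v. weak_derivative t0 t1 x v \<and>
        weakly_in sym_pairing t0 t1 D x
          (\<lambda>t. ((v t, f t, - y t), (gradient H (x t), e t, u t)))) \<and>
     weakly_in symp_pairing t0 t1 R x (\<lambda>t. (f t, e t))}"


section \<open>Interconnection\<close>

text \<open>
  The external port of each subsystem is the product of the remaining external port and the
  interconnection port.
\<close>

definition interconnect ::
    "('n1 \<Rightarrow> (('n1 \<times> 'r1 \<times> 'ep1 \<times> 'ip1) \<times> ('n1 \<times> 'r1 \<times> 'ep1 \<times> 'ip1)) set) \<Rightarrow>
     ('n1 \<times> 'n2 \<Rightarrow> (('ip1 \<times> 'ip2) \<times> ('ip1 \<times> 'ip2)) set) \<Rightarrow>
     ('n2 \<Rightarrow> (('n2 \<times> 'r2 \<times> 'ep2 \<times> 'ip2) \<times> ('n2 \<times> 'r2 \<times> 'ep2 \<times> 'ip2)) set) \<Rightarrow>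
     'n1 \<times> 'n2 \<Rightarrow>
       ((('n1 \<times> 'n2) \<times> ('r1 \<times> 'r2) \<times> ('ep1 \<times> 'ep2)) \<times>
        (('n1 \<times> 'n2) \<times> ('r1 \<times> 'r2) \<times> ('ep1 \<times> 'ep2))) set" where
  "interconnect D1 Dint D2 = (\<lambda>(x1, x2).
     {(((v1, v2), (f1, f2), (\<eta>1, \<eta>2)), ((\<alpha>1, \<alpha>2), (e1, e2), (u1, u2)))
       | v1 v2 f1 f2 \<eta>1 \<eta>2 \<alpha>1 \<alpha>2 e1 e2 u1 u2.
       \<exists>\<zeta>1 \<zeta>2 w1 w2. ((\<zeta>1, \<zeta>2), (w1, w2)) \<in> Dint (x1, x2) \<and>
         ((v1, f1, \<eta>1, \<zeta>1), (\<alpha>1, e1, u1, w1)) \<in> D1 x1 \<and>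
         ((v2, f2, \<eta>2, \<zeta>2), (\<alpha>2, e2, u2, w2)) \<in> D2 x2})"

definition behaviour_interconnect ::
    "(real \<Rightarrow> real \<Rightarrow> ('n1, 'r1, 'ep1 \<times> 'ip1::ab_group_add) curves) \<Rightarrow>
     ('n1 \<times> 'n2 \<Rightarrow> (('ip1 \<times> 'ip2::ab_group_add) \<times> ('ip1 \<times> 'ip2)) set) \<Rightarrow>
     (real \<Rightarrow> real \<Rightarrow> ('n2, 'r2, 'ep2 \<times> 'ip2) curves) \<Rightarrow>
     real \<Rightarrow> real \<Rightarrow> ('n1 \<times> 'n2, 'r1 \<times> 'r2, 'ep1 \<times> 'ep2) curves" where
  "behaviour_interconnect B1 Dint B2 t0 t1 = {(x, f, y, e, u).
     \<exists>yb1 yb2 ub1 ub2.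
       (\<forall>t\<in>{t0..t1}. ((yb1 t, yb2 t), (ub1 t, ub2 t)) \<in> Dint (x t)) \<and>
       (\<lambda>t. fst (x t), \<lambda>t. fst (f t), \<lambda>t. (fst (y t), - yb1 t),
        \<lambda>t. fst (e t), \<lambda>t. (fst (u t), ub1 t)) \<in> B1 t0 t1 \<and>
       (\<lambda>t. snd (x t), \<lambda>t. snd (f t), \<lambda>t. (snd (y t), - yb2 t),
        \<lambda>t. snd (e t), \<lambda>t. (snd (u t), ub2 t)) \<in> B2 t0 t1}"

end

theory Submission
  imports Defs
begin

text \<open>
  For a constant Dirac structure the weak relation is the almost everywhere relation: testing with
  $\varphi(t)\,d$ for a fixed element $d$ of the fibre $D$ and applying the fundamental lemma of
  the calculus of variations shows that the curve lies almost everywhere in the orthogonal space of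
  $D$ for the symmetric pairing, and this space is $D$ because $D$ is isotropic of half dimension.
  The composed structure has the same property: a vector orthogonal to it, extended by $0$ on the
  interconnection ports, lies in the double orthogonal complement of
  $(D_1 \times D_2) + (0 \times D_{\mathrm{int}})$.

  The interconnection variables are recovered from the external ones by a linear section of the
  projection onto the composed structure.  Being linear, it turns continuous curves into continuous
  ones and integrable curves into integrable ones; being defined on the whole space with values in
  $D_{\mathrm{int}}$, it gives curves in $D_{\mathrm{int}}$ at every time, although the external
  variables lie in the composed structure only almost everywhere.
\<close>

section \<open>Linear algebra and gradients\<close>

text \<open>For the composed structure no rank is transported, but isotropy and coisotropy
  separately. Each implication between the weak and the almost everywhere relation rests on one of
  the two: isotropy makes every admissible test integrand vanish, coisotropy brings a curve
  annihilated by all tests back into the fibre. Both pass through the interconnection by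
  orthogonality arguments; dimensions are counted only once, for a given half-dimensional structure.
  The resistive bundles may vary with the base point, so a fixed vector is in general no admissible
  test direction. There the test curves themselves are split into components and padded by zero,
  which is why each fibre has to contain zero. The linear algebra is built on finite orthogonal
  spanning sets, which stay meaningful, possibly empty, when a port space is trivial.\<close>

lemma subspace_orthogonal_basis:
  fixes S :: "'a::fd_inner set"
  assumes "subspace S"
  obtains C where "finite C" "pairwise orthogonal C" "0 \<notin> C" "span C = S"
proof -
  obtain A :: "'a set" where A: "finite A" "span A = UNIV"
    using finite_span by blast
  obtain B where B: "B \<subseteq> S" "independent B" "S \<subseteq> span B"
    using real_vector.basis_exists[of S] by metis
  have "finite B"
    using real_vector.independent_span_bound[OF A(1) B(2)] A(2) by blast
  moreover have "span B = S"
    using B assms by (simp add: antisym span_minimal)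
  ultimately obtain C where "finite C" "pairwise orthogonal C" "span C = S"
    using basis_orthogonal[of B] by metis
  \<comment> \<open>Orthogonality alone permits the zero vector; removing it makes the set
    independent, so that its cardinality is the dimension.\<close>
  then show ?thesis
    using that[of "C - {0}"] by (simp add: span_delete_0 pairwise_subset[of _ C])
qed

lemma orthogonal_remainder:
  assumes "finite C" "pairwise orthogonal C" "y \<in> span C"
  shows "(x - (\<Sum>b\<in>C. (x \<bullet> b / (b \<bullet> b)) *\<^sub>R b)) \<bullet> y = 0"
  using assms(3)
proof (induction rule: span_induct_alt)
  case base
  then show ?case by simp
next
  case (step c z y)
  \<comment> \<open>A zero vector in \<open>C\<close> does no harm: for \<open>z = 0\<close> its
    term on the left and \<open>x \<bullet> z\<close> are both 0.\<close>
  have "(\<Sum>b\<in>C. (x \<bullet> b / (b \<bullet> b)) * (b \<bullet> z)) = (\<Sum>b\<in>C. if b = z then x \<bullet> z else 0)"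
    using assms(2) step(1) by (intro sum.cong) (auto simp: pairwise_def orthogonal_def)
  then have "(x - (\<Sum>b\<in>C. (x \<bullet> b / (b \<bullet> b)) *\<^sub>R b)) \<bullet> z = 0"
    using assms(1) step(1) by (simp add: inner_diff_left inner_sum_left)
  then show ?case
    using step by (simp add: inner_add_right)
qed

lemma orthogonal_expansion:
  assumes "finite C" "pairwise orthogonal C" "x \<in> span C"
  shows "x = (\<Sum>b\<in>C. (x \<bullet> b / (b \<bullet> b)) *\<^sub>R b)"
proof -
  let ?r = "x - (\<Sum>b\<in>C. (x \<bullet> b / (b \<bullet> b)) *\<^sub>R b)"
  have "?r \<in> span C"
    by (intro span_diff assms(3) span_sum span_scale span_base)
  then have "?r \<bullet> ?r = 0"
    using orthogonal_remainder[OF assms(1,2)] by blast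
  then show ?thesis by simp
qed

text \<open>The orthogonal projection of \<open>x\<close> onto \<open>S\<close> leaves a remainder
  orthogonal to \<open>S\<close>. The hypothesis makes \<open>x\<close> orthogonal to this
  remainder, so the remainder is orthogonal to itself.\<close>

lemma orthogonal_orthogonal_subset:
  fixes S :: "'a::fd_inner set"
  assumes "subspace S" "\<And>z. (\<And>s. s \<in> S \<Longrightarrow> z \<bullet> s = 0) \<Longrightarrow> x \<bullet> z = 0"
  shows "x \<in> S"
proof -
  obtain C where C: "finite C" "pairwise orthogonal C" "span C = S"
    using subspace_orthogonal_basis[OF assms(1)] by metis
  let ?p = "\<Sum>b\<in>C. (x \<bullet> b / (b \<bullet> b)) *\<^sub>R b"
  have p: "?p \<in> S"
    unfolding C(3)[symmetric] by (intro span_sum span_scale span_base)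
  have r: "(x - ?p) \<bullet> s = 0" if "s \<in> S" for s
    using orthogonal_remainder[OF C(1,2)] that C(3) by blast
  have "x \<bullet> (x - ?p) = 0"
    by (rule assms(2)) (rule r)
  moreover have "(x - ?p) \<bullet> ?p = 0"
    by (rule r[OF p])
  ultimately have "(x - ?p) \<bullet> (x - ?p) = 0"
    by (simp add: inner_diff_right inner_commute)
  then show ?thesis
    using p by simp
qed

text \<open>Expanding the argument along an orthogonal spanning set exhibits \<open>f\<close> as a
  finite sum of coordinate functionals with fixed vector coefficients. This is what carries
  continuity and integrability through the section of the interconnection.\<close>

lemma linear_imp_bounded_linear:
  fixes f :: "'a::fd_inner \<Rightarrow> 'b::real_normed_vector"
  assumes "linear f"
  shows "bounded_linear f"
proof -
  obtain C :: "'a set" where C: "finite C" "pairwise orthogonal C" "span C = UNIV"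
    using subspace_orthogonal_basis[OF subspace_UNIV] by metis
  have expand: "x = (\<Sum>b\<in>C. (x \<bullet> b / (b \<bullet> b)) *\<^sub>R b)" for x
    by (rule orthogonal_expansion[OF C(1,2)]) (simp add: C(3))
  have "f x = (\<Sum>b\<in>C. (x \<bullet> b) *\<^sub>R ((1 / (b \<bullet> b)) *\<^sub>R f b))" for x
    by (subst expand[of x]) (simp add: linear_sum[OF assms] linear_cmul[OF assms])
  then have "f = (\<lambda>x. \<Sum>b\<in>C. (x \<bullet> b) *\<^sub>R ((1 / (b \<bullet> b)) *\<^sub>R f b))"
    by (rule ext)
  moreover have "bounded_linear (\<lambda>x. \<Sum>b\<in>C. (x \<bullet> b) *\<^sub>R ((1 / (b \<bullet> b)) *\<^sub>R f b))"
    by (intro bounded_linear_sum bounded_linear_scaleR_const bounded_linear_inner_left)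
  ultimately show ?thesis by metis
qed

section \<open>Gradients of smooth functions\<close>

lemma differentiable_imp_GDERIV_gradient:
  fixes H :: "'a::fd_inner \<Rightarrow> real"
  assumes "H differentiable (at x)"
  shows "GDERIV H x :> gradient H x"
proof -
  obtain C :: "'a set" where C: "finite C" "pairwise orthogonal C" "span C = UNIV"
    using subspace_orthogonal_basis[OF subspace_UNIV] by metis
  have expand: "x = (\<Sum>b\<in>C. (x \<bullet> b / (b \<bullet> b)) *\<^sub>R b)" for x
    by (rule orthogonal_expansion[OF C(1,2)]) (simp add: C(3))
  let ?F = "frechet_derivative H (at x)"
  \<comment> \<open>The Riesz representative of the derivative: its coefficient at \<open>b\<close>
    is the derivative in direction \<open>b\<close>, normalised by
    \<open>b \<bullet> b\<close>.\<close>
  let ?g = "\<Sum>b\<in>C. (?F b / (b \<bullet> b)) *\<^sub>R b"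
  have F: "(H has_derivative ?F) (at x)"
    using assms by (simp add: frechet_derivative_works)
  then have lin: "linear ?F"
    by (rule has_derivative_linear)
  have "?F h = h \<bullet> ?g" for h
    by (subst expand[of h])
      (simp add: linear_sum[OF lin] linear_cmul[OF lin] inner_sum_right mult.commute)
  then have "?F = (\<lambda>h. h \<bullet> ?g)"
    by (rule ext)
  with F have "(H has_derivative (\<lambda>h. h \<bullet> ?g)) (at x)"
    by (rule has_derivative_eq_rhs)
  then have g: "GDERIV H x :> ?g"
    unfolding gderiv_def .
  \<comment> \<open>\<open>gradient\<close> is a definite description, so uniqueness has to
    accompany existence.\<close>
  have "g' = ?g" if "GDERIV H x :> g'" for g'
  proof -
    have "(\<lambda>h. h \<bullet> g') = (\<lambda>h. h \<bullet> ?g)"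
      using g that unfolding gderiv_def by (rule has_derivative_unique[rotated])
    then have "h \<bullet> g' = h \<bullet> ?g" for h
      by (rule fun_cong)
    then show ?thesis
      using vector_eq_ldot by blast
  qed
  then show ?thesis
    unfolding gradient_def by (rule theI[where P = "\<lambda>g. GDERIV H x :> g", OF g])
qed

lemma gradient_eqI:
  fixes H :: "'a::fd_inner \<Rightarrow> real"
  assumes "GDERIV H x :> g"
  shows "gradient H x = g"
proof -
  have "GDERIV H x :> gradient H x"
    using assms by (intro differentiable_imp_GDERIV_gradient) (auto simp: gderiv_def differentiable_def)
  then have "(\<lambda>h. h \<bullet> gradient H x) = (\<lambda>h. h \<bullet> g)"
    using assms unfolding gderiv_def by (rule has_derivative_unique)
  then have "h \<bullet> gradient H x = h \<bullet> g" for h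
    by (rule fun_cong)
  then show ?thesis
    using vector_eq_ldot by blast
qed

lemma smooth_on_differentiable:
  "smooth_on S f \<Longrightarrow> x \<in> S \<Longrightarrow> f differentiable (at x)"
  unfolding smooth_on_def by (metis Ck_on.simps(2))

lemma smooth_on_continuous_frechet_derivative:
  "smooth_on S f \<Longrightarrow> continuous_on S (\<lambda>x. frechet_derivative f (at x) v)"
  unfolding smooth_on_def by (metis Ck_on.simps)

text \<open>Smoothness gives continuity of the derivative in each fixed direction; an expansion of
  the gradient along finitely many orthogonal directions turns this into continuity of the vector
  itself.\<close>

lemma continuous_on_gradient:
  fixes H :: "'a::fd_inner \<Rightarrow> real"
  assumes "smooth_on U H"
  shows "continuous_on U (gradient H)"
proof -
  obtain C :: "'a set" where C: "finite C" "pairwise orthogonal C" "span C = UNIV"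
    using subspace_orthogonal_basis[OF subspace_UNIV] by metis
  have expand: "x = (\<Sum>b\<in>C. (x \<bullet> b / (b \<bullet> b)) *\<^sub>R b)" for x
    by (rule orthogonal_expansion[OF C(1,2)]) (simp add: C(3))
  have "gradient H x = (\<Sum>b\<in>C. (frechet_derivative H (at x) b / (b \<bullet> b)) *\<^sub>R b)" if "x \<in> U" for x
  proof -
    have "GDERIV H x :> gradient H x"
      using assms that by (intro differentiable_imp_GDERIV_gradient smooth_on_differentiable)
    then have F: "frechet_derivative H (at x) = (\<lambda>h. h \<bullet> gradient H x)"
      unfolding gderiv_def using frechet_derivative_at by metis
    show ?thesis
      unfolding F inner_commute[of _ "gradient H x"] by (rule expand)
  qed
  then have *: "continuous_on U (gradient H) \<longleftrightarrow>
      continuous_on U (\<lambda>x. \<Sum>b\<in>C. (frechet_derivative H (at x) b / (b \<bullet> b)) *\<^sub>R b)"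
    by (rule continuous_on_cong[OF refl])
  show ?thesis
    unfolding * divide_inverse
    by (intro continuous_intros smooth_on_continuous_frechet_derivative assms)
qed

lemma gradient_add_prod:
  fixes H1 :: "'a::fd_inner \<Rightarrow> real" and H2 :: "'b::fd_inner \<Rightarrow> real"
  assumes "smooth_on U1 H1" "smooth_on U2 H2" "x \<in> U1 \<times> U2"
  shows "gradient (\<lambda>(x1, x2). H1 x1 + H2 x2) x = (gradient H1 (fst x), gradient H2 (snd x))"
proof (rule gradient_eqI)
  have 1: "(H1 has_derivative (\<lambda>h. h \<bullet> gradient H1 (fst x))) (at (fst x))"
    using differentiable_imp_GDERIV_gradient[OF smooth_on_differentiable[OF assms(1)]] assms(3)
    unfolding gderiv_def by auto
  have 2: "(H2 has_derivative (\<lambda>h. h \<bullet> gradient H2 (snd x))) (at (snd x))"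
    using differentiable_imp_GDERIV_gradient[OF smooth_on_differentiable[OF assms(2)]] assms(3)
    unfolding gderiv_def by auto
  have "((\<lambda>x. H1 (fst x) + H2 (snd x)) has_derivative
      (\<lambda>h. fst h \<bullet> gradient H1 (fst x) + snd h \<bullet> gradient H2 (snd x))) (at x)"
    using has_derivative_compose[OF has_derivative_fst[OF has_derivative_ident] 1]
      has_derivative_compose[OF has_derivative_snd[OF has_derivative_ident] 2]
    by (rule has_derivative_add)
  then show "GDERIV (\<lambda>(x1, x2). H1 x1 + H2 x2) x :> (gradient H1 (fst x), gradient H2 (snd x))"
    by (simp add: gderiv_def case_prod_unfold inner_prod_def)
qed

section \<open>Constant Dirac structures\<close>

text \<open>The half of maximal isotropy that leads from vanishing test integrals back to
  membership. It is isolated because, unlike a rank condition, it passes through an interconnection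
  by orthogonality alone.\<close>

definition coisotropic :: "('v::real_inner \<times> 'v) set \<Rightarrow> bool" where
  "coisotropic D \<longleftrightarrow> (\<forall>q. (\<forall>p\<in>D. sym_pairing q p = 0) \<longrightarrow> q \<in> D)"

text \<open>Exchanging flow and effort turns the indefinite pairing into the Euclidean one, for
  which orthogonal expansions and complements are available.\<close>

lemma sym_pairing_eq_inner: "sym_pairing p q = p \<bullet> prod.swap q"
  by (cases p; cases q) (simp add: inner_commute add.commute)

lemma sym_pairing_commute: "sym_pairing p q = sym_pairing q p"
  by (cases p; cases q) (simp add: inner_commute add.commute)

lemma symp_pairing_eq_inner: "symp_pairing (f, e) q = f \<bullet> snd q - e \<bullet> fst q"
  by (cases q) (simp add: inner_commute)

lemma sym_pairing_scaleR_right: "sym_pairing p (r *\<^sub>R q) = r * sym_pairing p q"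
  by (cases p; cases q) (simp add: algebra_simps)

lemma subspace_orthogonal_complement:
  "subspace {q. \<forall>p\<in>D. sym_pairing q p = 0}"
  by (auto simp: subspace_def sym_pairing_eq_inner inner_add_left)

lemma linear_swap: "linear prod.swap"
  by (rule linearI) auto

lemma swap_inner_swap: "prod.swap p \<bullet> prod.swap q = p \<bullet> q"
  by (cases p; cases q) simp

text \<open>Provides the upper bound for an exchange argument: no independent set of the product
  space has more than twice the dimension of \<open>'v\<close> elements.\<close>

lemma product_spanning_set:
  "\<exists>T :: ('v::fd_inner \<times> 'v) set.
     finite T \<and> span T = UNIV \<and> card T \<le> 2 * dim (UNIV :: 'v set)"
proof -
  obtain A :: "'v set" where "A \<subseteq> UNIV" and A: "independent A" "UNIV \<subseteq> span A" "card A = dim (UNIV :: 'v set)"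
    by (rule real_vector.basis_exists)
  then have A: "independent A" "span A = UNIV" "card A = dim (UNIV :: 'v set)"
    by auto
  obtain B :: "'v set" where B: "finite B" "span B = UNIV"
    using finite_span by blast
  have "finite A"
    using real_vector.independent_span_bound[OF B(1) A(1)] B(2) by simp
  let ?T = "(\<lambda>a. (a, 0)) ` A \<union> (\<lambda>a. (0, a)) ` A"
  have "linear (\<lambda>a::'v. (a, 0::'v))" "linear (\<lambda>a::'v. (0::'v, a))"
    by (rule linearI; simp)+
  then have sp: "span ((\<lambda>a. (a, 0::'v)) ` A) = range (\<lambda>a. (a, 0))"
     "span ((\<lambda>a. (0::'v, a)) ` A) = range (\<lambda>a. (0, a))"
    by (simp_all only: linear_span_image A(2))
  have "z \<in> span ?T" for z
  proof -
    have "(fst z, 0) \<in> span ?T"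
      by (rule subsetD[OF span_mono[OF Un_upper1]]) (unfold sp, blast)
    moreover have "(0, snd z) \<in> span ?T"
      by (rule subsetD[OF span_mono[OF Un_upper2]]) (unfold sp, blast)
    ultimately have "(fst z, 0) + (0, snd z) \<in> span ?T"
      by (rule span_add)
    then show ?thesis by simp
  qed
  then have "UNIV = span ?T"
    by (rule UNIV_eq_I)
  moreover have "card ?T \<le> 2 * dim (UNIV :: 'v set)"
    using card_Un_le[of "(\<lambda>a. (a, 0::'v)) ` A" "(\<lambda>a. (0::'v, a)) ` A"]
      card_image_le[OF \<open>finite A\<close>, of "\<lambda>a. (a, 0::'v)"]
      card_image_le[OF \<open>finite A\<close>, of "\<lambda>a. (0::'v, a)"]
    unfolding A(3) by linarith
  moreover have "finite ?T"
    using \<open>finite A\<close> by simp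
  ultimately show ?thesis
    by metis
qed

text \<open>Isotropy says that \<open>D\<close> is Euclidean-orthogonal to its swapped copy. Both
  have the dimension of \<open>'v\<close>, so together they fill the product space and
  \<open>q\<close> splits into a vector of \<open>D\<close> and one of the swapped copy. If
  \<open>q\<close> pairs to zero with \<open>D\<close>, the second component is orthogonal to itself
  and vanishes.\<close>

lemma isotropic_rank_imp_coisotropic:
  fixes D :: "('v::fd_inner \<times> 'v) set"
  assumes "subspace D" "dim D = dim (UNIV :: 'v set)"
    and iso: "\<And>p q. p \<in> D \<Longrightarrow> q \<in> D \<Longrightarrow> sym_pairing p q = 0"
  shows "coisotropic D"
proof -
  let ?s = "prod.swap :: 'v \<times> 'v \<Rightarrow> _"
  obtain B where B: "finite B" "pairwise orthogonal B" "0 \<notin> B" "span B = D"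
    using subspace_orthogonal_basis[OF assms(1)] .
  have cardB: "card B = dim (UNIV :: 'v set)"
    using real_vector.dim_eq_card_independent[OF pairwise_orthogonal_independent[OF B(2,3)]]
      dim_span[of B] unfolding B(4) assms(2) by simp
  have orth: "p \<bullet> ?s q = 0" if "p \<in> D" "q \<in> D" for p q
    using iso[OF that] by (simp add: sym_pairing_eq_inner)
  have BD: "B \<subseteq> D"
    using B(4) span_superset by blast
  have span_swap: "span (?s ` B) = ?s ` D"
    unfolding linear_span_image[OF linear_swap] B(4) ..
  \<comment> \<open>Within \<open>B\<close> and within its swapped copy this is orthogonality of the
    basis; across the two it is isotropy.\<close>
  have "pairwise orthogonal (B \<union> ?s ` B)"
    unfolding pairwise_def orthogonal_def
  proof (intro ballI impI)
    have BB: "p \<bullet> q = 0" if "p \<in> B" "q \<in> B" "p \<noteq> q" for p q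
      using B(2) that by (simp add: pairwise_def orthogonal_def)
    have Bs: "p \<bullet> ?s q = 0" if "p \<in> B" "q \<in> B" for p q
      using orth[OF subsetD[OF BD that(1)] subsetD[OF BD that(2)]] .
    fix p q assume "p \<in> B \<union> ?s ` B" "q \<in> B \<union> ?s ` B" "p \<noteq> q"
    then consider "p \<in> B" "q \<in> B" | q' where "p \<in> B" "q' \<in> B" "q = ?s q'"
      | p' where "p' \<in> B" "q \<in> B" "p = ?s p'"
      | p' q' where "p' \<in> B" "q' \<in> B" "p = ?s p'" "q = ?s q'"
      by blast
    then show "p \<bullet> q = 0"
    proof cases
      case 1
      then show ?thesis using BB \<open>p \<noteq> q\<close> by simp
    next
      case 2
      then show ?thesis using Bs by simp
    next
      case 3
      then show ?thesis using Bs[of q p'] by (simp add: inner_commute)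
    next
      case 4
      then have "p' \<noteq> q'"
        using \<open>p \<noteq> q\<close> by auto
      then show ?thesis
        using 4 BB[of p' q'] by (simp add: swap_inner_swap)
    qed
  qed
  moreover have "0 \<notin> B \<union> ?s ` B"
    using B(3) by (auto simp: zero_prod_def)
  ultimately have ind: "independent (B \<union> ?s ` B)"
    by (rule pairwise_orthogonal_independent)
  \<comment> \<open>A common vector would be orthogonal to itself; disjointness lets the two
    cardinalities add up.\<close>
  have "B \<inter> ?s ` B = {}"
  proof (rule ccontr)
    assume "B \<inter> ?s ` B \<noteq> {}"
    then obtain p q where pq: "p \<in> B" "q \<in> B" "p = ?s q" by blast
    then have "p \<bullet> p = 0"
      using orth[OF subsetD[OF BD pq(1)] subsetD[OF BD pq(2)]] by simp
    then show False
      using pq(1) B(3) by simp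
  qed
  then have card: "card (B \<union> ?s ` B) = 2 * dim (UNIV :: 'v set)"
    using B(1) cardB by (simp add: card_Un_disjoint card_image)
  obtain T :: "('v \<times> 'v) set"
    where T: "finite T" "span T = UNIV" "card T \<le> 2 * dim (UNIV :: 'v set)"
    using product_spanning_set by blast
  have "x \<in> span (B \<union> ?s ` B)" for x
  proof (rule ccontr)
    assume x: "x \<notin> span (B \<union> ?s ` B)"
    \<comment> \<open>One more independent vector would exceed the size of the spanning set
      \<open>T\<close>.\<close>
    then have "independent (insert x (B \<union> ?s ` B))"
      using ind by (simp add: independent_insert)
    then have "card (insert x (B \<union> ?s ` B)) \<le> card T"
      using real_vector.independent_span_bound[OF T(1)] unfolding T(2) by simp
    moreover have "card (insert x (B \<union> ?s ` B)) = Suc (card (B \<union> ?s ` B))"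
    proof (rule card_insert_disjoint)
      show "finite (B \<union> ?s ` B)"
        using B(1) by simp
      show "x \<notin> B \<union> ?s ` B"
        using x span_base[of x] by metis
    qed
    ultimately show False
      using card T(3) by simp
  qed
  then have spanned: "x \<in> span (B \<union> ?s ` B)" for x .
  have decomp: "\<exists>p q. x = p + ?s q \<and> p \<in> D \<and> q \<in> D" for x
  proof -
    have "x \<in> {p + q | p q. p \<in> D \<and> q \<in> ?s ` D}"
      using spanned[of x] unfolding span_Un span_swap B(4) .
    then show ?thesis by blast
  qed
  show ?thesis
    unfolding coisotropic_def
  proof (intro allI impI)
    fix q assume q: "\<forall>p\<in>D. sym_pairing q p = 0"
    obtain a b where ab: "q = a + ?s b" "a \<in> D" "b \<in> D"
      using decomp[of q] by (elim exE conjE)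
    \<comment> \<open>Pairing \<open>q\<close> with \<open>b\<close> is the Euclidean product of
      \<open>q\<close> with \<open>?s b\<close>, to which \<open>a\<close> contributes
      nothing.\<close>
    have "?s b \<bullet> ?s b = 0"
      using q ab orth by (simp add: sym_pairing_eq_inner inner_add_left)
    then show "q \<in> D"
      using ab by simp
  qed
qed

text \<open>A frame over a single point of \<open>U\<close> determines the dimension of the common
  fibre, which together with isotropy gives coisotropy.\<close>

lemma dirac_constantE:
  fixes D :: "'a::fd_inner \<Rightarrow> ('v::fd_inner \<times> 'v) set"
  assumes "dirac_structure U D" "constant_bundle U D" "U \<noteq> {}"
  obtains D0 where "subspace D0" "\<forall>x\<in>U. D x = D0" "coisotropic D0"
    "\<forall>p\<in>D0. \<forall>q\<in>D0. sym_pairing p q = 0"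
proof -
  let ?n = "dim (UNIV :: 'v set)"
  obtain D0 where D0: "subspace D0" "\<And>x. x \<in> U \<Longrightarrow> D x = D0"
    using assms(2) unfolding constant_bundle_def by blast
  obtain x where x: "x \<in> U" using assms(3) by blast
  obtain s where s: "inj_on (\<lambda>i. s i x) {..<?n}" "independent ((\<lambda>i. s i x) ` {..<?n})"
    "D x = span ((\<lambda>i. s i x) ` {..<?n})"
    using assms(1) x unfolding dirac_structure_def smooth_subbundle_def by metis
  have iso: "\<And>p q. p \<in> D0 \<Longrightarrow> q \<in> D0 \<Longrightarrow> sym_pairing p q = 0"
    using assms(1) x D0(2) unfolding dirac_structure_def by metis
  have "coisotropic D0"
    using D0(1) _ iso
  proof (rule isotropic_rank_imp_coisotropic)
    show "dim D0 = ?n"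
      using s D0(2)[OF x]
      by (metis card_image card_lessThan dim_span real_vector.dim_eq_card_independent)
  qed
  then show ?thesis
    using that D0 iso by blast
qed

section \<open>The interconnected fibre\<close>

text \<open>
  \<open>external_part\<close> and \<open>port_part\<close> split a pair of elements of the two fibres into the variables
  kept by the interconnection and the interconnection port variables; \<open>glue\<close> is the inverse
  reshuffling.
\<close>

type_synonym ('n, 'r, 'p, 'i) sys = "('n \<times> 'r \<times> 'p \<times> 'i) \<times> ('n \<times> 'r \<times> 'p \<times> 'i)"

type_synonym ('n, 'r, 'p) ext = "('n \<times> 'r \<times> 'p) \<times> ('n \<times> 'r \<times> 'p)"

fun external_part ::
  "('n1::fd_inner, 'r1::fd_inner, 'p1::fd_inner, 'i1::fd_inner) sys \<times>
   ('n2::fd_inner, 'r2::fd_inner, 'p2::fd_inner, 'i2::fd_inner) sys \<Rightarrow>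
   ('n1 \<times> 'n2, 'r1 \<times> 'r2, 'p1 \<times> 'p2) ext" where
  "external_part (((v1, f1, n1, z1), (a1, e1, u1, w1)), ((v2, f2, n2, z2), (a2, e2, u2, w2))) =
     (((v1, v2), (f1, f2), (n1, n2)), ((a1, a2), (e1, e2), (u1, u2)))"

fun port_part ::
  "('n1::fd_inner, 'r1::fd_inner, 'p1::fd_inner, 'i1::fd_inner) sys \<times>
   ('n2::fd_inner, 'r2::fd_inner, 'p2::fd_inner, 'i2::fd_inner) sys \<Rightarrow>
   ('i1 \<times> 'i2) \<times> ('i1 \<times> 'i2)" where
  "port_part (((v1, f1, n1, z1), (a1, e1, u1, w1)), ((v2, f2, n2, z2), (a2, e2, u2, w2))) =
     ((z1, z2), (w1, w2))"

fun glue ::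
  "('n1::fd_inner \<times> 'n2::fd_inner, 'r1::fd_inner \<times> 'r2::fd_inner,
    'p1::fd_inner \<times> 'p2::fd_inner) ext \<Rightarrow>
   ('i1::fd_inner \<times> 'i2::fd_inner) \<times> ('i1 \<times> 'i2) \<Rightarrow>
   ('n1, 'r1, 'p1, 'i1) sys \<times> ('n2, 'r2, 'p2, 'i2) sys" where
  "glue ((v, f, n), (a, e, u)) (z, w) =
     (((fst v, fst f, fst n, fst z), (fst a, fst e, fst u, fst w)),
      ((snd v, snd f, snd n, snd z), (snd a, snd e, snd u, snd w)))"

lemma external_part_glue [simp]: "external_part (glue c w) = c"
  by (cases "(c, w)" rule: glue.cases) simp

lemma port_part_glue [simp]: "port_part (glue c w) = w"
  by (cases "(c, w)" rule: glue.cases) simp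

lemma glue_parts: "glue (external_part d) (port_part d) = d"
  by (cases d rule: external_part.cases) simp

lemma linear_external_part: "linear external_part"
proof (rule linearI)
  show "external_part (a + b) = external_part a + external_part b" for a b
    by (cases a rule: external_part.cases; cases b rule: external_part.cases) simp
  show "external_part (r *\<^sub>R a) = r *\<^sub>R external_part a" for r a
    by (cases a rule: external_part.cases) simp
qed

lemma linear_port_part: "linear port_part"
proof (rule linearI)
  show "port_part (a + b) = port_part a + port_part b" for a b
    by (cases a rule: external_part.cases; cases b rule: external_part.cases) simp
  show "port_part (r *\<^sub>R a) = r *\<^sub>R port_part a" for r a
    by (cases a rule: external_part.cases) simp
qed

text \<open>With zero external variables, gluing embeds the interconnection ports linearly; the
  image of \<open>W\<close> under it is the second summand in the orthogonality argument
  below.\<close>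

lemma linear_glue_0: "linear (glue 0)"
proof (rule linearI)
  show "glue 0 (a + b) = glue 0 a + glue 0 b" for a b
    by (cases a; cases b) (simp add: zero_prod_def)
  show "glue 0 (r *\<^sub>R a) = r *\<^sub>R glue 0 a" for r a
    by (cases a) (simp add: zero_prod_def)
qed

lemma inner_glue: "d \<bullet> glue c w = external_part d \<bullet> c + port_part d \<bullet> w"
  by (cases d rule: external_part.cases; cases "(c, w)" rule: glue.cases)
    (simp add: inner_prod_def)

lemma inner_parts: "d \<bullet> d' = external_part d \<bullet> external_part d' + port_part d \<bullet> port_part d'"
  using inner_glue[of d "external_part d'" "port_part d'"] by (simp only: glue_parts)

lemma external_part_swap:
  "external_part (map_prod prod.swap prod.swap d) = prod.swap (external_part d)"
  by (cases d rule: external_part.cases) simp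

lemma port_part_swap:
  "port_part (map_prod prod.swap prod.swap d) = prod.swap (port_part d)"
  by (cases d rule: external_part.cases) simp

text \<open>For constant structures the base point disappears and the composition becomes an
  operation on three subspaces.\<close>

definition interconnect_fibre where
  "interconnect_fibre A W B = {c. \<exists>w\<in>W. glue c w \<in> A \<times> B}"

lemma interconnect_eq_fibre:
  "interconnect D1 Dint D2 x = interconnect_fibre (D1 (fst x)) (Dint x) (D2 (snd x))"
proof (cases x)
  case (Pair x1 x2)
  show ?thesis
    unfolding Pair interconnect_def interconnect_fibre_def by (auto, force+)
qed

text \<open>Seen as the projection of all compatible pairs, the composed fibre is the linear image
  of a subspace. The subspace property, isotropy and the linear section all start from this
  form.\<close>

lemma interconnect_fibre_eq_image:
  "interconnect_fibre A W B = external_part ` {d \<in> A \<times> B. port_part d \<in> W}"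
proof (intro subset_antisym subsetI)
  fix c assume "c \<in> interconnect_fibre A W B"
  then obtain w where "w \<in> W" "glue c w \<in> A \<times> B"
    unfolding interconnect_fibre_def mem_Collect_eq by (elim bexE)
  then show "c \<in> external_part ` {d \<in> A \<times> B. port_part d \<in> W}"
    by (intro image_eqI[where x = "glue c w"]) simp_all
next
  fix c assume "c \<in> external_part ` {d \<in> A \<times> B. port_part d \<in> W}"
  then obtain d where d: "c = external_part d" "d \<in> A \<times> B" "port_part d \<in> W"
    unfolding image_iff mem_Collect_eq Bex_def by (elim exE conjE)
  have "glue c (port_part d) \<in> A \<times> B"
    using d(2) unfolding d(1) glue_parts .
  then show "c \<in> interconnect_fibre A W B"
    unfolding interconnect_fibre_def mem_Collect_eq using d(3) by (rule bexI)
qed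

lemma subspace_compatible:
  assumes "subspace A" "subspace B" "subspace W"
  shows "subspace {d \<in> A \<times> B. port_part d \<in> W}"
proof -
  have "{d \<in> A \<times> B. port_part d \<in> W} = (A \<times> B) \<inter> port_part -` W"
    by blast
  then show ?thesis
    by (simp only:) (intro subspace_inter subspace_Times linear_subspace_vimage linear_port_part assms)
qed

lemma subspace_interconnect_fibre:
  assumes "subspace A" "subspace B" "subspace W"
  shows "subspace (interconnect_fibre A W B)"
  unfolding interconnect_fibre_eq_image
  by (intro linear_subspace_image linear_external_part subspace_compatible assms)

lemma interconnect_fibre_linear_selection:
  assumes "subspace A" "subspace B" "subspace W"
  obtains h where "linear h" "\<And>c. h c \<in> W"
    "\<And>c. c \<in> interconnect_fibre A W B \<Longrightarrow> glue c (h c) \<in> A \<times> B"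
proof -
  let ?K = "{d \<in> A \<times> B. port_part d \<in> W}"
  \<comment> \<open>The right inverse takes values in \<open>?K\<close> even at arguments outside
    the composed fibre. Hence its port part always lies in \<open>W\<close>, whereas it inverts the
    projection on the fibre only.\<close>
  obtain g where g: "range g \<subseteq> ?K" "linear g" "\<forall>c\<in>external_part ` ?K. external_part (g c) = c"
    using linear_exists_right_inverse_on[OF linear_external_part subspace_compatible[OF assms]]
    by (elim exE conjE)
  show ?thesis
  proof
    show "linear (\<lambda>c. port_part (g c))"
      using linear_compose[OF g(2) linear_port_part] by (simp add: o_def)
    show "port_part (g c) \<in> W" for c
      using g(1) by (auto simp only: image_subset_iff mem_Collect_eq)
    show "glue c (port_part (g c)) \<in> A \<times> B" if c: "c \<in> interconnect_fibre A W B" for c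
    proof -
      have "external_part (g c) = c"
        using c g(3) unfolding interconnect_fibre_eq_image by (rule bspec[rotated])
      then have "glue c (port_part (g c)) = g c"
        using glue_parts[of "g c"] by simp
      moreover have "g c \<in> A \<times> B"
        using g(1) by (auto simp only: image_subset_iff mem_Collect_eq)
      ultimately show ?thesis
        by (simp only:)
    qed
  qed
qed

text \<open>The pairing of two compatible pairs is the sum of an external and a port contribution.
  The total vanishes by isotropy of \<open>A\<close> and \<open>B\<close>, the port contribution by
  isotropy of \<open>W\<close>, and so the external one vanishes too.\<close>

lemma interconnect_fibre_isotropic:
  assumes "\<And>p q. p \<in> A \<Longrightarrow> q \<in> A \<Longrightarrow> sym_pairing p q = 0"
    and "\<And>p q. p \<in> B \<Longrightarrow> q \<in> B \<Longrightarrow> sym_pairing p q = 0"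
    and "\<And>p q. p \<in> W \<Longrightarrow> q \<in> W \<Longrightarrow> sym_pairing p q = 0"
    and "c \<in> interconnect_fibre A W B" "c' \<in> interconnect_fibre A W B"
  shows "sym_pairing c c' = 0"
proof -
  have parts: "\<exists>d. c = external_part d \<and> fst d \<in> A \<and> snd d \<in> B \<and> port_part d \<in> W"
    if "c \<in> interconnect_fibre A W B" for c
    using that unfolding interconnect_fibre_eq_image image_iff Bex_def mem_Collect_eq mem_Times_iff
    by (simp only: conj_ac)
  obtain d where d: "c = external_part d" "fst d \<in> A" "snd d \<in> B" "port_part d \<in> W"
    using parts[OF assms(4)] by (elim exE conjE)
  obtain d' where d': "c' = external_part d'" "fst d' \<in> A" "snd d' \<in> B" "port_part d' \<in> W"
    using parts[OF assms(5)] by (elim exE conjE)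
  \<comment> \<open>Swapping flow and effort in each subsystem separately writes the sum of the two
    pairings as a single Euclidean product.\<close>
  have "d \<bullet> map_prod prod.swap prod.swap d' = sym_pairing (fst d) (fst d') + sym_pairing (snd d) (snd d')"
    by (simp add: sym_pairing_eq_inner inner_prod_def[of d] map_prod_def case_prod_unfold)
  moreover have "d \<bullet> map_prod prod.swap prod.swap d' = sym_pairing c c' + sym_pairing (port_part d) (port_part d')"
    unfolding inner_parts[of d] external_part_swap port_part_swap sym_pairing_eq_inner d d' ..
  ultimately show ?thesis
    using assms(1)[OF d(2) d'(2)] assms(2)[OF d(3) d'(3)] assms(3)[OF d(4) d'(4)] by simp
qed

lemma coisotropicD: "coisotropic D \<Longrightarrow> (\<And>p. p \<in> D \<Longrightarrow> sym_pairing q p = 0) \<Longrightarrow> q \<in> D"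
  unfolding coisotropic_def by blast

text \<open>Projecting the ports away is dual to extending by zero. A vector orthogonal to
  \<open>?S\<close> becomes, after swapping, a compatible pair, so its swapped external part is a
  legitimate test vector for \<open>c\<close>.\<close>

lemma interconnect_fibre_coisotropic:
  assumes "subspace A" "subspace B" "subspace W"
    and "coisotropic A" "coisotropic B" "coisotropic W"
  shows "coisotropic (interconnect_fibre A W B)"
  unfolding coisotropic_def
proof (intro allI impI)
  fix c assume c: "\<forall>p\<in>interconnect_fibre A W B. sym_pairing c p = 0"
  let ?S = "{d + d' | d d'. d \<in> A \<times> B \<and> d' \<in> glue 0 ` W}"
  have "subspace ?S"
    by (intro subspace_sums subspace_Times linear_subspace_image linear_glue_0 assms)
  moreover have "glue c 0 \<bullet> z = 0" if z: "\<And>s. s \<in> ?S \<Longrightarrow> z \<bullet> s = 0" for z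
  proof -
    have 0: "0 \<in> A" "0 \<in> B" "0 \<in> W"
      using assms(1-3) by (auto intro: subspace_0)
    have AB: "z \<bullet> d = 0" if "d \<in> A \<times> B" for d
    proof (rule z)
      have "d = d + glue 0 0"
        by (simp add: linear_0[OF linear_glue_0])
      then show "d \<in> ?S"
        using that 0(3) by blast
    qed
    have W: "z \<bullet> glue 0 w = 0" if "w \<in> W" for w
    proof (rule z)
      have "glue 0 w = (0, 0) + glue 0 w"
        by (simp add: zero_prod_def[symmetric])
      then show "glue 0 w \<in> ?S"
        using that 0(1,2) by blast
    qed
    \<comment> \<open>Orthogonality to \<open>A \<times> B\<close> is tested with one component zero
      at a time; coisotropy then puts each swapped component into its fibre.\<close>
    have "prod.swap (fst z) \<in> A"
    proof (rule coisotropicD[OF assms(4)])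
      show "sym_pairing (prod.swap (fst z)) p = 0" if "p \<in> A" for p
        using AB[of "(p, 0)"] that 0
        by (simp add: sym_pairing_eq_inner swap_inner_swap inner_prod_def[of z])
    qed
    moreover have "prod.swap (snd z) \<in> B"
    proof (rule coisotropicD[OF assms(5)])
      show "sym_pairing (prod.swap (snd z)) p = 0" if "p \<in> B" for p
        using AB[of "(0, p)"] that 0
        by (simp add: sym_pairing_eq_inner swap_inner_swap inner_prod_def[of z])
    qed
    \<comment> \<open>The summand coming from \<open>W\<close> forces the swapped ports to obey the
      interconnection constraint.\<close>
    moreover have "prod.swap (port_part z) \<in> W"
    proof (rule coisotropicD[OF assms(6)])
      show "sym_pairing (prod.swap (port_part z)) p = 0" if "p \<in> W" for p
        using W[OF that] by (simp add: sym_pairing_eq_inner swap_inner_swap inner_glue)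
    qed
    ultimately have "map_prod prod.swap prod.swap z \<in> A \<times> B"
        "port_part (map_prod prod.swap prod.swap z) \<in> W"
      by (simp_all only: port_part_swap mem_Times_iff fst_map_prod snd_map_prod)
    then have "prod.swap (external_part z) \<in> interconnect_fibre A W B"
      unfolding interconnect_fibre_eq_image external_part_swap[symmetric]
      by (simp only: imageI mem_Collect_eq)
    then have "sym_pairing c (prod.swap (external_part z)) = 0"
      using c by (rule bspec[rotated])
    then show ?thesis
      using inner_glue[of z c 0] by (simp add: sym_pairing_eq_inner inner_commute)
  qed
  ultimately have "glue c 0 \<in> ?S"
    by (rule orthogonal_orthogonal_subset)
  \<comment> \<open>The decomposition supplies the witness: \<open>d\<close> has external part
    \<open>c\<close>, and its ports are \<open>- w\<close>, again an element of
    \<open>W\<close>.\<close>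
  then obtain d w where dw: "glue c 0 = d + glue 0 w" "d \<in> A \<times> B" "w \<in> W"
    unfolding mem_Collect_eq image_iff Bex_def by (elim exE conjE) simp
  have "external_part d = c"
    using arg_cong[OF dw(1), of external_part] by (simp add: linear_add[OF linear_external_part])
  moreover have "port_part d = - w"
    using arg_cong[OF dw(1), of port_part]
    by (simp add: linear_add[OF linear_port_part] eq_neg_iff_add_eq_0)
  ultimately show "c \<in> interconnect_fibre A W B"
    unfolding interconnect_fibre_eq_image using dw(2) subspace_neg[OF assms(3) dw(3)]
    by (intro image_eqI[of _ _ d]) simp_all
qed

section \<open>The weak sense and weak derivatives\<close>

lemma integrable_continuous_interval:
  fixes f :: "real \<Rightarrow> 'b::{banach, second_countable_topology}"
  assumes "continuous_on {a..b} f"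
  shows "integrable (lebesgue_on {a..b}) f"
proof -
  interpret finite_measure "lebesgue_on {a..b}"
    by (rule finite_measure_lebesgue_on) simp
  have "bounded (f ` {a..b})"
    using assms by (intro compact_imp_bounded compact_continuous_image) auto
  then obtain K where "\<forall>t\<in>{a..b}. norm (f t) \<le> K"
    unfolding bounded_iff by blast
  then show ?thesis
    using continuous_imp_measurable_on_sets_lebesgue[OF assms]
    by (intro integrable_const_bound[of _ K]) (auto intro!: AE_I2)
qed

text \<open>A continuous factor is bounded on a compact interval, so the product is dominated by a
  multiple of the integrable factor. The bilinear form covers inner products and scalar multiples
  alike.\<close>

lemma integrable_bilinear_continuous:
  fixes prod :: "'a::fd_inner \<Rightarrow> 'b::fd_inner \<Rightarrow> 'c::{banach, second_countable_topology}"
    and f :: "real \<Rightarrow> 'a"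
  assumes "bounded_bilinear prod" "integrable (lebesgue_on {a..b}) f" "continuous_on {a..b} g"
  shows "integrable (lebesgue_on {a..b}) (\<lambda>t. prod (f t) (g t))"
proof -
  interpret bounded_bilinear prod by fact
  obtain K where K: "K > 0" "\<And>x y. norm (prod x y) \<le> norm x * norm y * K"
    using pos_bounded by blast
  have "bounded (g ` {a..b})"
    using assms by (intro compact_imp_bounded compact_continuous_image) auto
  then obtain B where B: "\<forall>t\<in>{a..b}. norm (g t) \<le> B" "B > 0"
    unfolding bounded_pos by blast
  have meas: "f \<in> borel_measurable (lebesgue_on {a..b})" "g \<in> borel_measurable (lebesgue_on {a..b})"
    using assms continuous_imp_measurable_on_sets_lebesgue[OF assms(3)] by auto
  have "continuous_on UNIV (\<lambda>x. prod (fst x) (snd x))"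
    by (intro continuous_on continuous_on_fst continuous_on_snd continuous_on_id)
  then have "(\<lambda>x. prod (fst x) (snd x)) \<in> borel_measurable (borel \<Otimes>\<^sub>M borel)"
    unfolding borel_prod by (rule borel_measurable_continuous_onI)
  from measurable_compose[OF measurable_Pair[OF meas] this]
  have m: "(\<lambda>t. prod (f t) (g t)) \<in> borel_measurable (lebesgue_on {a..b})" by simp
  show ?thesis
  proof (rule Bochner_Integration.integrable_bound[OF _ m])
    show "integrable (lebesgue_on {a..b}) (\<lambda>t. B * K * norm (f t))"
      using assms(2) by simp
    have "norm (prod (f t) (g t)) \<le> norm (B * K * norm (f t))" if "t \<in> {a..b}" for t
    proof -
      have "norm (prod (f t) (g t)) \<le> norm (f t) * norm (g t) * K" by (rule K)
      also have "\<dots> \<le> norm (f t) * B * K"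
        using B K(1) that by (intro mult_right_mono mult_left_mono) auto
      finally show ?thesis
        using B K(1) by (simp add: abs_mult mult_ac)
    qed
    then show "AE t in lebesgue_on {a..b}. norm (prod (f t) (g t)) \<le> norm (B * K * norm (f t))"
      by (intro AE_I2) simp
  qed
qed

lemmas integrable_inner_continuous =
  integrable_bilinear_continuous[OF bounded_bilinear_inner]
text \<open>Dominated convergence extends the vanishing from continuous test functions to indicators
  of compact sets, which are approximated from above by cutoffs of the distance to the set.\<close>

lemma compact_integral_zero:
  fixes g :: "real \<Rightarrow> real"
  assumes g: "integrable (lebesgue_on {a..b}) g"
    and zero: "\<And>\<phi>. continuous_on {a..b} \<phi> \<Longrightarrow> compact_support_in a b \<phi> {a..b} \<Longrightarrow>
      (LINT t|lebesgue_on {a..b}. g t * \<phi> t) = 0"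
    and K: "compact K" "K \<subseteq> {a<..<b}"
  shows "(LINT t|lebesgue_on {a..b}. g t * indicator K t) = 0"
proof (cases "K = {}")
  case True
  then show ?thesis by simp
next
  case False
  obtain c d where cd: "a < c" "d < b" "K \<subseteq> {c..d}"
  proof
    show "a < Inf K" "Sup K < b" "K \<subseteq> {Inf K..Sup K}"
      using K False closed_contains_Inf[of K] closed_contains_Sup[of K]
        cInf_lower[of _ K] cSup_upper[of _ K]
      by (auto simp: compact_eq_bounded_closed bounded_imp_bdd_above bounded_imp_bdd_below subset_iff)
  qed
  \<comment> \<open>Half of the smaller margin: the \<open>\<delta>\<close>-neighbourhood of
    \<open>{c..d}\<close> still lies in a compact subset of the open interval, common to all
    cutoffs.\<close>
  define \<delta> where "\<delta> = min (c - a) (b - d) / 2"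
  have \<delta>: "\<delta> > 0" "a < c - \<delta>" "d + \<delta> < b"
    using cd unfolding \<delta>_def by (auto simp: min_def field_simps)
  \<comment> \<open>Equal to 1 on \<open>K\<close> and to 0 at distance at least
    \<open>\<delta> / Suc n\<close>; thanks to \<open>Suc\<close> the cutoff of index 0 fits into
    the margin as well.\<close>
  define \<phi> where "\<phi> n t = max 0 (1 - real (Suc n) / \<delta> * infdist t K)" for n :: nat and t :: real
  have \<phi>_cont: "continuous_on {a..b} (\<phi> n)" for n
    unfolding \<phi>_def by (intro continuous_intros)
  have far: "\<phi> n t = 0" if "t \<notin> {c - \<delta>..d + \<delta>}" for n t
  proof -
    obtain k where k: "k \<in> K" "infdist t K = dist t k"
      using infdist_attains_inf[of K t] K(1) False by (auto simp: compact_imp_closed)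
    have "\<delta> \<le> infdist t K"
      using k cd(3) that by (auto simp: dist_real_def subset_iff not_le)
    also have "\<dots> \<le> real (Suc n) * infdist t K"
      using infdist_nonneg[of t K] mult_right_mono[of 1 "real (Suc n)" "infdist t K"] by simp
    finally show ?thesis
      unfolding \<phi>_def using \<delta>(1) by (simp add: max_def field_simps)
  qed
  have supp: "compact_support_in a b (\<phi> n) {a..b}" for n
    unfolding compact_support_in_def using \<delta> far[of _ n]
    by (intro exI[of _ "{c - \<delta>..d + \<delta>}"]) auto
  have lim: "(\<lambda>n. \<phi> n t) \<longlonglongrightarrow> indicator K t" for t
  proof (cases "t \<in> K")
    case True
    then show ?thesis by (simp add: \<phi>_def)
  next
    case False
    then have "infdist t K > 0"
      using K(1) \<open>K \<noteq> {}\<close> by (simp add: infdist_pos_not_in_closed compact_imp_closed)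
    then obtain N where N: "\<delta> / infdist t K < real N"
      using reals_Archimedean2 by blast
    have "\<phi> n t = 0" if "n \<ge> N" for n
    proof -
      have "\<delta> / infdist t K < real (Suc n)"
        using N that by linarith
      then show ?thesis
        unfolding \<phi>_def using \<delta>(1) \<open>infdist t K > 0\<close> by (simp add: max_def field_simps)
    qed
    then have "eventually (\<lambda>n. \<phi> n t = 0) sequentially"
      unfolding eventually_sequentially by blast
    then show ?thesis
      using False by (simp add: tendsto_eventually)
  qed
  have bound: "\<bar>\<phi> n t\<bar> \<le> 1" for n t
  proof -
    have "0 \<le> real (Suc n) / \<delta> * infdist t K"
      using \<delta>(1) infdist_nonneg[of t K] by simp
    then show ?thesis
      unfolding \<phi>_def by linarith
  qed
  have "(\<lambda>n. LINT t|lebesgue_on {a..b}. g t * \<phi> n t) \<longlonglongrightarrow>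
      (LINT t|lebesgue_on {a..b}. g t * indicator K t)"
  proof (rule integral_dominated_convergence[where w = "\<lambda>t. \<bar>g t\<bar>"])
    have g_meas: "g \<in> borel_measurable (lebesgue_on {a..b})"
      using g by simp
    have \<phi>_meas: "\<phi> n \<in> borel_measurable (lebesgue_on {a..b})" for n
      by (rule continuous_imp_measurable_on_sets_lebesgue[OF \<phi>_cont]) simp
    show "(\<lambda>t. g t * \<phi> n t) \<in> borel_measurable (lebesgue_on {a..b})" for n
      by (rule borel_measurable_times[OF g_meas \<phi>_meas])
    have "(indicator K :: real \<Rightarrow> real) \<in> borel_measurable (lebesgue_on {a..b})"
      by (rule borel_measurable_LIMSEQ_real[OF lim \<phi>_meas])
    with g_meas show "(\<lambda>t. g t * indicator K t) \<in> borel_measurable (lebesgue_on {a..b})"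
      by (rule borel_measurable_times)
    show "integrable (lebesgue_on {a..b}) (\<lambda>t. \<bar>g t\<bar>)"
      using g by simp
    show "AE t in lebesgue_on {a..b}. (\<lambda>n. g t * \<phi> n t) \<longlonglongrightarrow> g t * indicator K t"
      by (intro AE_I2 tendsto_intros lim)
    show "AE t in lebesgue_on {a..b}. norm (g t * \<phi> n t) \<le> \<bar>g t\<bar>" for n
      using mult_left_mono[OF bound abs_ge_zero] by (intro AE_I2) (simp add: abs_mult)
  qed
  moreover have "(LINT t|lebesgue_on {a..b}. g t * \<phi> n t) = 0" for n
    by (rule zero[OF \<phi>_cont supp])
  ultimately show ?thesis
    by (simp add: LIMSEQ_const_iff)
qed

text \<open>Up to a null set, the set where \<open>g\<close> is positive is a countable union of
  compact sets. On each of them a positive function has integral zero, so each is null.\<close>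

lemma fundamental_lemma_variations_nonpos:
  fixes g :: "real \<Rightarrow> real"
  assumes g: "integrable (lebesgue_on {a..b}) g"
    and zero: "\<And>\<phi>. continuous_on {a..b} \<phi> \<Longrightarrow> compact_support_in a b \<phi> {a..b} \<Longrightarrow>
      (LINT t|lebesgue_on {a..b}. g t * \<phi> t) = 0"
  shows "AE t in lebesgue_on {a..b}. g t \<le> 0"
proof -
  have [measurable]: "g \<in> borel_measurable (lebesgue_on {a..b})"
    using g by simp
  \<comment> \<open>The endpoints are left out because test functions are supported in the open
    interval; they return at the end as a null set.\<close>
  let ?A = "{t \<in> {a<..<b}. g t > 0}"
  have "{t \<in> space (lebesgue_on {a..b}). g t > 0} \<in> sets (lebesgue_on {a..b})"
    by measurable
  then have "{t \<in> {a..b}. g t > 0} \<in> sets lebesgue"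
    by (simp add: sets_restrict_space_iff)
  then have "{t \<in> {a..b}. g t > 0} \<inter> {a<..<b} \<in> sets lebesgue"
    by (rule sets.Int) simp
  moreover have "{t \<in> {a..b}. g t > 0} \<inter> {a<..<b} = ?A" by auto
  ultimately have "?A \<in> sets lebesgue" by simp
  then obtain C T where C: "fsigma C" "T \<in> null_sets lebesgue" "C \<union> T = ?A"
    using lebesgue_set_almost_fsigma by metis
  obtain F :: "nat \<Rightarrow> real set" where F: "range F \<subseteq> Collect compact" "C = \<Union> (range F)"
    using C(1) unfolding fsigma_Union_compact by blast
  have "F n \<in> null_sets lebesgue" for n
  proof -
    have K: "compact (F n)" "F n \<subseteq> ?A"
      using F C(3) by auto
    then have meas: "F n \<in> sets (lebesgue_on {a..b})"
      by (subst sets_restrict_space_iff) (auto intro: fmeasurableD lmeasurable_compact)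
    have "(LINT t|lebesgue_on {a..b}. g t * indicator (F n) t) = 0"
      using K by (intro compact_integral_zero[OF g zero]) auto
    moreover have "integrable (lebesgue_on {a..b}) (\<lambda>t. g t * indicator (F n) t)"
      using integrable_mult_indicator[OF meas g] by (simp add: mult.commute)
    moreover have "g t * indicator (F n) t \<ge> 0" for t
      using K(2) by (auto simp: indicator_def)
    ultimately have "AE t in lebesgue_on {a..b}. g t * indicator (F n) t = 0"
      by (subst (asm) integral_nonneg_eq_0_iff_AE) auto
    then have "AE t in lebesgue_on {a..b}. t \<notin> F n"
      by eventually_elim (use K(2) in \<open>auto simp: indicator_def split: if_splits\<close>)
    then have "F n \<in> null_sets (lebesgue_on {a..b})"
      using meas by (simp add: AE_iff_null_sets)
    then show ?thesis
      using K(2) by (subst (asm) null_sets_restrict_space) auto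
  qed
  then have "C \<in> null_sets lebesgue"
    unfolding F(2) by (rule null_sets_UN)
  then have "?A \<in> null_sets lebesgue"
    using C(2,3) null_sets.Un by metis
  moreover have "{a, b} \<in> null_sets lebesgue"
    by (intro null_sets_completionI finite_imp_null_set_lborel) simp
  ultimately have "?A \<union> {a, b} \<in> null_sets lebesgue"
    by (rule null_sets.Un)
  then have "AE t in lebesgue. t \<notin> ?A \<union> {a, b}"
    by (rule AE_not_in)
  then have "AE t in lebesgue. t \<in> {a..b} \<longrightarrow> g t \<le> 0"
    by eventually_elim (auto simp: not_less)
  then show ?thesis
    by (simp add: AE_restrict_space_iff)
qed

lemma fundamental_lemma_variations:
  fixes g :: "real \<Rightarrow> real"
  assumes "integrable (lebesgue_on {a..b}) g"
    and zero: "\<And>\<phi>. continuous_on {a..b} \<phi> \<Longrightarrow> compact_support_in a b \<phi> {a..b} \<Longrightarrow>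
      (LINT t|lebesgue_on {a..b}. g t * \<phi> t) = 0"
  shows "AE t in lebesgue_on {a..b}. g t = 0"
proof -
  have "AE t in lebesgue_on {a..b}. g t \<le> 0"
    using assms by (rule fundamental_lemma_variations_nonpos)
  moreover have "AE t in lebesgue_on {a..b}. - g t \<le> 0"
    using assms by (intro fundamental_lemma_variations_nonpos) auto
  ultimately show ?thesis
    by eventually_elim simp
qed

text \<open>A finite spanning set of \<open>D\<close> provides enough test directions: finitely many
  exceptional null sets unite into one, and outside of it linearity extends the vanishing to all of
  \<open>D\<close>.\<close>

lemma weakly_in_imp_AE:
  fixes D :: "('v::fd_inner \<times> 'v) set"
  assumes D: "subspace D" "coisotropic D"
    and E: "\<And>t. t \<in> {t0..t1} \<Longrightarrow> E (x t) = D"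
    and c: "L1_curve t0 t1 c" and weak: "weakly_in sym_pairing t0 t1 E x c"
  shows "AE t in lebesgue_on {t0..t1}. c t \<in> D"
proof -
  obtain C where C: "finite C" "pairwise orthogonal C" "0 \<notin> C" "span C = D"
    using subspace_orthogonal_basis[OF D(1)] .
  have "AE t in lebesgue_on {t0..t1}. sym_pairing (c t) d = 0" if "d \<in> C" for d
  proof (rule fundamental_lemma_variations)
    show "integrable (lebesgue_on {t0..t1}) (\<lambda>t. sym_pairing (c t) d)"
      using c unfolding L1_curve_def sym_pairing_eq_inner
      by (rule integrable_bounded_linear[OF bounded_linear_inner_left])
    fix \<phi> :: "real \<Rightarrow> real"
    assume \<phi>: "continuous_on {t0..t1} \<phi>" "compact_support_in t0 t1 \<phi> {t0..t1}"
    have "d \<in> D"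
      using span_base[OF that] C(4) by simp
    have "continuous_on {t0..t1} (\<lambda>t. \<phi> t *\<^sub>R d)"
      by (intro continuous_intros \<phi>)
    moreover have "compact_support_in t0 t1 (\<lambda>t. \<phi> t *\<^sub>R d) {t0..t1}"
      using \<phi>(2) unfolding compact_support_in_def by force
    moreover have "\<forall>t\<in>{t0..t1}. \<phi> t *\<^sub>R d \<in> E (x t)"
      using E subspace_scale[OF D(1) \<open>d \<in> D\<close>] by simp
    ultimately have "(LINT t|lebesgue_on {t0..t1}. sym_pairing (c t) (\<phi> t *\<^sub>R d)) = 0"
      using weak unfolding weakly_in_def by blast
    then show "(LINT t|lebesgue_on {t0..t1}. sym_pairing (c t) d * \<phi> t) = 0"
      by (simp add: sym_pairing_scaleR_right mult.commute)
  qed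
  then have "AE t in lebesgue_on {t0..t1}. \<forall>d\<in>C. sym_pairing (c t) d = 0"
    by (intro AE_finite_allI C(1))
  then show ?thesis
  proof eventually_elim
    case (elim t)
    have "subspace {p. sym_pairing (c t) p = 0}"
      using subspace_orthogonal_complement[of "{c t}"] by (simp add: sym_pairing_commute[of "c t"])
    then have "span C \<subseteq> {p. sym_pairing (c t) p = 0}"
      using elim by (intro span_minimal) (simp_all add: subset_eq)
    then show ?case
      unfolding C(4) by (intro coisotropicD[OF D(2)]) (simp add: subset_eq)
  qed
qed

text \<open>Test values lie in the same isotropic fibre as almost every \<open>c t\<close>, so the
  integrand itself vanishes almost everywhere.\<close>

lemma AE_imp_weakly_in:
  assumes iso: "\<And>p q. p \<in> D \<Longrightarrow> q \<in> D \<Longrightarrow> sym_pairing p q = 0"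
    and E: "\<And>t. t \<in> {t0..t1} \<Longrightarrow> E (x t) = D"
    and c: "AE t in lebesgue_on {t0..t1}. c t \<in> D"
  shows "weakly_in sym_pairing t0 t1 E x c"
  unfolding weakly_in_def
proof (intro allI impI, elim conjE)
  fix p assume p: "\<forall>t\<in>{t0..t1}. p t \<in> E (x t)"
  have "AE t in lebesgue_on {t0..t1}. t \<in> {t0..t1}"
    using AE_space[of "lebesgue_on {t0..t1}"] by simp
  with c have "AE t in lebesgue_on {t0..t1}. sym_pairing (c t) (p t) = 0"
    by eventually_elim (use p E iso in auto)
  then show "(LINT t|lebesgue_on {t0..t1}. sym_pairing (c t) (p t)) = 0"
    by (rule integral_eq_zero_AE)
qed

section \<open>Componentwise rules for curves in product spaces\<close>

lemma L1_curve_bounded_linear: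
  "bounded_linear T \<Longrightarrow> L1_curve t0 t1 f \<Longrightarrow> L1_curve t0 t1 (\<lambda>t. T (f t))"
  unfolding L1_curve_def by (rule integrable_bounded_linear)

lemma L1_curve_Pair:
  assumes "L1_curve t0 t1 f" "L1_curve t0 t1 g"
  shows "L1_curve t0 t1 (\<lambda>t. (f t, g t))"
proof -
  have "L1_curve t0 t1 (\<lambda>t. (f t, 0) + (0, g t))"
    using L1_curve_bounded_linear[OF linear_imp_bounded_linear, of "\<lambda>a. (a, 0)" t0 t1 f]
      L1_curve_bounded_linear[OF linear_imp_bounded_linear, of "\<lambda>a. (0, a)" t0 t1 g] assms
    unfolding L1_curve_def by (intro Bochner_Integration.integrable_add) (auto simp: linear_iff)
  then show ?thesis by simp
qed

lemma L1_curve_Pair_iff: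
  "L1_curve t0 t1 (\<lambda>t. (f t, g t)) \<longleftrightarrow> L1_curve t0 t1 f \<and> L1_curve t0 t1 g"
  using L1_curve_Pair L1_curve_bounded_linear[OF bounded_linear_fst, of t0 t1 "\<lambda>t. (f t, g t)"]
    L1_curve_bounded_linear[OF bounded_linear_snd, of t0 t1 "\<lambda>t. (f t, g t)"] by auto

lemma L1_curve_minus_iff: "L1_curve t0 t1 (\<lambda>t. - f t) \<longleftrightarrow> L1_curve t0 t1 f"
  unfolding L1_curve_def by simp

lemma L1_curve_prod_iff:
  "L1_curve t0 t1 f \<longleftrightarrow> L1_curve t0 t1 (\<lambda>t. fst (f t)) \<and> L1_curve t0 t1 (\<lambda>t. snd (f t))"
  using L1_curve_Pair_iff[of t0 t1 "\<lambda>t. fst (f t)" "\<lambda>t. snd (f t)"] by simp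

lemma continuous_on_prod_iff:
  "continuous_on S f \<longleftrightarrow> continuous_on S (\<lambda>t. fst (f t)) \<and> continuous_on S (\<lambda>t. snd (f t))"
proof
  assume "continuous_on S (\<lambda>t. fst (f t)) \<and> continuous_on S (\<lambda>t. snd (f t))"
  then have "continuous_on S (\<lambda>t. (fst (f t), snd (f t)))"
    by (intro continuous_on_Pair) auto
  then show "continuous_on S f" by simp
qed (auto intro: continuous_on_fst continuous_on_snd)

lemma continuous_on_linear:
  fixes T :: "'a::fd_inner \<Rightarrow> 'b::real_normed_vector"
  assumes "linear T" "continuous_on S f"
  shows "continuous_on S (\<lambda>t. T (f t))"
  using linear_imp_bounded_linear[OF assms(1)] assms(2) by (rule bounded_linear.continuous_on)

lemma L1_curve_continuous: "continuous_on {t0..t1} f \<Longrightarrow> L1_curve t0 t1 f"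
  unfolding L1_curve_def by (rule integrable_continuous_interval)

lemma compact_support_in_map:
  assumes "compact_support_in t0 t1 p I" "F 0 = 0"
  shows "compact_support_in t0 t1 (\<lambda>t. F (p t)) I"
proof -
  obtain K where "compact K" "K \<subseteq> {t0<..<t1}" "\<forall>t\<in>I - K. p t = 0"
    using assms(1) unfolding compact_support_in_def by blast
  then show ?thesis
    unfolding compact_support_in_def using assms(2) by (intro exI[of _ K]) simp
qed

lemma weakly_inD:
  assumes "weakly_in B t0 t1 E x c" "continuous_on {t0..t1} p" "compact_support_in t0 t1 p {t0..t1}"
    "\<And>t. t \<in> {t0..t1} \<Longrightarrow> p t \<in> E (x t)"
  shows "(LINT t|lebesgue_on {t0..t1}. B (c t) (p t)) = 0"
  using assms unfolding weakly_in_def by blast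

lemma prod_bundle_iff:
  "p \<in> prod_bundle R1 R2 x \<longleftrightarrow>
     (fst (fst p), fst (snd p)) \<in> R1 (fst x) \<and> (snd (fst p), snd (snd p)) \<in> R2 (snd x)"
  unfolding prod_bundle_def by (cases p; cases x) force

lemma integrable_symp_pairing:
  assumes "L1_curve t0 t1 f" "L1_curve t0 t1 e" "continuous_on {t0..t1} p"
  shows "integrable (lebesgue_on {t0..t1}) (\<lambda>t. symp_pairing (f t, e t) (p t))"
  unfolding symp_pairing_eq_inner using assms unfolding L1_curve_def
  by (intro Bochner_Integration.integrable_diff integrable_inner_continuous
      continuous_on_fst continuous_on_snd)

text \<open>The fibres may vary, so the equivalence is obtained on the level of test curves: one for
  a factor becomes one for the product when padded with zero, and one for the product splits into
  its two components.\<close>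

lemma weakly_in_prod_bundle:
  fixes f e :: "real \<Rightarrow> 'v::fd_inner \<times> 'w::fd_inner"
  assumes L1: "L1_curve t0 t1 f" "L1_curve t0 t1 e"
    and zero: "\<And>t. t \<in> {t0..t1} \<Longrightarrow> 0 \<in> R1 (fst (x t))" "\<And>t. t \<in> {t0..t1} \<Longrightarrow> 0 \<in> R2 (snd (x t))"
  shows "weakly_in symp_pairing t0 t1 (prod_bundle R1 R2) x (\<lambda>t. (f t, e t)) \<longleftrightarrow>
     weakly_in symp_pairing t0 t1 R1 (\<lambda>t. fst (x t)) (\<lambda>t. (fst (f t), fst (e t))) \<and>
     weakly_in symp_pairing t0 t1 R2 (\<lambda>t. snd (x t)) (\<lambda>t. (snd (f t), snd (e t)))"
    (is "?P \<longleftrightarrow> ?P1 \<and> ?P2")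
proof (intro iffI conjI)
  assume P: ?P
  show ?P1
    unfolding weakly_in_def
  proof (intro allI impI, elim conjE)
    fix p assume p: "continuous_on {t0..t1} p" "compact_support_in t0 t1 p {t0..t1}"
      "\<forall>t\<in>{t0..t1}. p t \<in> R1 (fst (x t))"
    let ?q = "\<lambda>t. ((fst (p t), 0 :: 'w), (snd (p t), 0 :: 'w))"
    have "(LINT t|lebesgue_on {t0..t1}. symp_pairing (f t, e t) (?q t)) = 0"
    proof (rule weakly_inD[OF P])
      show "continuous_on {t0..t1} ?q"
        by (intro continuous_intros p)
      show "compact_support_in t0 t1 ?q {t0..t1}"
        by (rule compact_support_in_map[OF p(2)]) (simp add: zero_prod_def)
      show "?q t \<in> prod_bundle R1 R2 (x t)" if "t \<in> {t0..t1}" for t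
        using p(3) zero(2) that by (simp add: prod_bundle_iff zero_prod_def)
    qed
    moreover have "symp_pairing (f t, e t) (?q t) = symp_pairing (fst (f t), fst (e t)) (p t)" for t
      by (simp add: symp_pairing_eq_inner inner_prod_def)
    ultimately show "(LINT t|lebesgue_on {t0..t1}. symp_pairing (fst (f t), fst (e t)) (p t)) = 0"
      by simp
  qed
  show ?P2
    unfolding weakly_in_def
  proof (intro allI impI, elim conjE)
    fix p assume p: "continuous_on {t0..t1} p" "compact_support_in t0 t1 p {t0..t1}"
      "\<forall>t\<in>{t0..t1}. p t \<in> R2 (snd (x t))"
    let ?q = "\<lambda>t. ((0 :: 'v, fst (p t)), (0 :: 'v, snd (p t)))"
    have "(LINT t|lebesgue_on {t0..t1}. symp_pairing (f t, e t) (?q t)) = 0"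
    proof (rule weakly_inD[OF P])
      show "continuous_on {t0..t1} ?q"
        by (intro continuous_intros p)
      show "compact_support_in t0 t1 ?q {t0..t1}"
        by (rule compact_support_in_map[OF p(2)]) (simp add: zero_prod_def)
      show "?q t \<in> prod_bundle R1 R2 (x t)" if "t \<in> {t0..t1}" for t
        using p(3) zero(1) that by (simp add: prod_bundle_iff zero_prod_def)
    qed
    moreover have "symp_pairing (f t, e t) (?q t) = symp_pairing (snd (f t), snd (e t)) (p t)" for t
      by (simp add: symp_pairing_eq_inner inner_prod_def)
    ultimately show "(LINT t|lebesgue_on {t0..t1}. symp_pairing (snd (f t), snd (e t)) (p t)) = 0"
      by simp
  qed
next
  assume "?P1 \<and> ?P2"
  then have P1: ?P1 and P2: ?P2 by simp_all
  show ?P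
    unfolding weakly_in_def
  proof (intro allI impI, elim conjE)
    fix p assume p: "continuous_on {t0..t1} p" "compact_support_in t0 t1 p {t0..t1}"
      "\<forall>t\<in>{t0..t1}. p t \<in> prod_bundle R1 R2 (x t)"
    let ?p1 = "\<lambda>t. (fst (fst (p t)), fst (snd (p t)))"
    let ?p2 = "\<lambda>t. (snd (fst (p t)), snd (snd (p t)))"
    have cont: "continuous_on {t0..t1} ?p1" "continuous_on {t0..t1} ?p2"
      by (intro continuous_intros p)+
    have supp: "compact_support_in t0 t1 ?p1 {t0..t1}" "compact_support_in t0 t1 ?p2 {t0..t1}"
      by (rule compact_support_in_map[OF p(2)], simp add: zero_prod_def)+
    have "(LINT t|lebesgue_on {t0..t1}. symp_pairing (fst (f t), fst (e t)) (?p1 t)) = 0"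
      using p(3) by (intro weakly_inD[OF P1 cont(1) supp(1)]) (simp add: prod_bundle_iff)
    moreover have "(LINT t|lebesgue_on {t0..t1}. symp_pairing (snd (f t), snd (e t)) (?p2 t)) = 0"
      using p(3) by (intro weakly_inD[OF P2 cont(2) supp(2)]) (simp add: prod_bundle_iff)
    moreover have "symp_pairing (f t, e t) (p t) =
        symp_pairing (fst (f t), fst (e t)) (?p1 t) + symp_pairing (snd (f t), snd (e t)) (?p2 t)" for t
      by (simp add: symp_pairing_eq_inner inner_prod_def)
    \<comment> \<open>Additivity of the integral needs both summands integrable, which an integrable
      curve paired with a continuous one provides.\<close>
    moreover have "integrable (lebesgue_on {t0..t1}) (\<lambda>t. symp_pairing (fst (f t), fst (e t)) (?p1 t))"
      using L1 L1_curve_prod_iff by (intro integrable_symp_pairing cont) blast+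
    moreover have "integrable (lebesgue_on {t0..t1}) (\<lambda>t. symp_pairing (snd (f t), snd (e t)) (?p2 t))"
      using L1 L1_curve_prod_iff by (intro integrable_symp_pairing cont) blast+
    ultimately show "(LINT t|lebesgue_on {t0..t1}. symp_pairing (f t, e t) (p t)) = 0"
      by (simp only: Bochner_Integration.integral_add)
  qed
qed

section \<open>Weak and classical derivatives of product curves\<close>

lemma smooth_on_deriv_continuous:
  fixes \<phi> :: "real \<Rightarrow> real"
  assumes "smooth_on UNIV \<phi>"
  shows "continuous_on UNIV (deriv \<phi>)"
proof -
  \<comment> \<open>Direction 1 connects the numerical derivative in the definition of weak
    derivatives with the directional derivatives in \<open>smooth_on\<close>.\<close>
  have "deriv \<phi> t = frechet_derivative \<phi> (at t) 1" for t
  proof -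
    have d: "(\<phi> has_derivative frechet_derivative \<phi> (at t)) (at t)"
      using smooth_on_differentiable[OF assms] by (simp add: frechet_derivative_works)
    have "frechet_derivative \<phi> (at t) h = frechet_derivative \<phi> (at t) 1 * h" for h
      using linear_cmul[OF has_derivative_linear[OF d], of h 1] by (simp add: mult.commute)
    then have "frechet_derivative \<phi> (at t) = (*) (frechet_derivative \<phi> (at t) 1)"
      by (rule ext)
    with d have "(\<phi> has_derivative (*) (frechet_derivative \<phi> (at t) 1)) (at t)"
      by (rule has_derivative_eq_rhs)
    then show ?thesis
      by (intro DERIV_imp_deriv) (simp only: has_field_derivative_def)
  qed
  then have "deriv \<phi> = (\<lambda>t. frechet_derivative \<phi> (at t) 1)"
    by (rule ext)
  then show ?thesis
    using smooth_on_continuous_frechet_derivative[OF assms] by (simp only:)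
qed

text \<open>The projections are bounded linear and commute with both integrals, once continuity of
  \<open>x\<close> and integrability of \<open>v\<close> make the two integrands integrable.\<close>

lemma weak_derivative_prod_iff:
  fixes x v :: "real \<Rightarrow> 'a::fd_inner \<times> 'b::fd_inner"
  assumes "continuous_on {t0..t1} x"
  shows "weak_derivative t0 t1 x v \<longleftrightarrow>
    weak_derivative t0 t1 (\<lambda>t. fst (x t)) (\<lambda>t. fst (v t)) \<and>
    weak_derivative t0 t1 (\<lambda>t. snd (x t)) (\<lambda>t. snd (v t))"
proof (cases "L1_curve t0 t1 v")
  case False
  then show ?thesis
    unfolding weak_derivative_def using L1_curve_prod_iff[of t0 t1 v] by blast
next
  case True
  let ?M = "lebesgue_on {t0..t1}"
  have "(LINT t|?M. deriv \<phi> t *\<^sub>R x t) = - (LINT t|?M. \<phi> t *\<^sub>R v t) \<longleftrightarrow>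
      (LINT t|?M. deriv \<phi> t *\<^sub>R fst (x t)) = - (LINT t|?M. \<phi> t *\<^sub>R fst (v t)) \<and>
      (LINT t|?M. deriv \<phi> t *\<^sub>R snd (x t)) = - (LINT t|?M. \<phi> t *\<^sub>R snd (v t))"
    if \<phi>: "smooth_on UNIV \<phi>" for \<phi>
  proof -
    have "continuous_on {t0..t1} (deriv \<phi>)"
      using smooth_on_deriv_continuous[OF \<phi>] by (rule continuous_on_subset) simp
    then have 1: "integrable ?M (\<lambda>t. deriv \<phi> t *\<^sub>R x t)"
      by (intro integrable_continuous_interval continuous_on_scaleR assms)
    have "continuous_on UNIV \<phi>"
      using smooth_on_differentiable[OF \<phi>]
      by (simp add: continuous_on_eq_continuous_at differentiable_imp_continuous_within)
    then have "continuous_on {t0..t1} \<phi>"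
      by (rule continuous_on_subset) simp
    then have 2: "integrable ?M (\<lambda>t. \<phi> t *\<^sub>R v t)"
      using True unfolding L1_curve_def
      by (intro integrable_bilinear_continuous[OF bounded_bilinear.flip[OF bounded_bilinear_scaleR]])
    show ?thesis
      using integral_bounded_linear[OF bounded_linear_fst 1] integral_bounded_linear[OF bounded_linear_snd 1]
        integral_bounded_linear[OF bounded_linear_fst 2] integral_bounded_linear[OF bounded_linear_snd 2]
      by (simp add: prod_eq_iff)
  qed
  then show ?thesis
    unfolding weak_derivative_def using L1_curve_prod_iff[of t0 t1 v] by blast
qed

text \<open>The extensions of the two components may live on different open intervals; the pair is
  extended to their intersection, which still contains the closed interval.\<close>

lemma C1_curve_prod_iff:
  "C1_curve t0 t1 (U1 \<times> U2) x \<longleftrightarrow>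
     C1_curve t0 t1 U1 (\<lambda>t. fst (x t)) \<and> C1_curve t0 t1 U2 (\<lambda>t. snd (x t))"
proof
  assume "C1_curve t0 t1 (U1 \<times> U2) x"
  then obtain a b z d where x: "continuous_on {t0..t1} x" "x ` {t0..t1} \<subseteq> U1 \<times> U2"
    and ab: "a < t0" "t1 < b" and eq: "\<forall>t\<in>{t0..t1}. z t = x t"
    and d: "\<forall>t\<in>{a<..<b}. (z has_vector_derivative d t) (at t)" "continuous_on {a<..<b} d"
    unfolding C1_curve_def C1_differentiable_on_def by (elim conjE exE)
  have "(\<lambda>t. fst (z t)) C1_differentiable_on {a<..<b}"
    unfolding C1_differentiable_on_def
    using d(1) continuous_on_fst[OF d(2)]
    by (intro exI[of _ "\<lambda>t. fst (d t)"]) (simp add: bounded_linear.has_vector_derivative[OF bounded_linear_fst])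
  moreover have "(\<lambda>t. snd (z t)) C1_differentiable_on {a<..<b}"
    unfolding C1_differentiable_on_def
    using d(1) continuous_on_snd[OF d(2)]
    by (intro exI[of _ "\<lambda>t. snd (d t)"]) (simp add: bounded_linear.has_vector_derivative[OF bounded_linear_snd])
  ultimately show "C1_curve t0 t1 U1 (\<lambda>t. fst (x t)) \<and> C1_curve t0 t1 U2 (\<lambda>t. snd (x t))"
    unfolding C1_curve_def using x ab eq
    by (intro conjI continuous_on_fst continuous_on_snd
        exI[of _ a] exI[of _ b] exI[of _ "\<lambda>t. fst (z t)"] exI[of _ "\<lambda>t. snd (z t)"])
      (auto simp: image_subset_iff mem_Times_iff)
next
  assume "C1_curve t0 t1 U1 (\<lambda>t. fst (x t)) \<and> C1_curve t0 t1 U2 (\<lambda>t. snd (x t))"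
  then have C1: "C1_curve t0 t1 U1 (\<lambda>t. fst (x t))" "C1_curve t0 t1 U2 (\<lambda>t. snd (x t))"
    by simp_all
  obtain a b z d where
    x: "continuous_on {t0..t1} (\<lambda>t. fst (x t))" "(\<lambda>t. fst (x t)) ` {t0..t1} \<subseteq> U1"
    and ab: "a < t0" "t1 < b" and eq: "\<forall>t\<in>{t0..t1}. z t = fst (x t)"
    and d: "\<forall>t\<in>{a<..<b}. (z has_vector_derivative d t) (at t)" "continuous_on {a<..<b} d"
    using C1(1) unfolding C1_curve_def C1_differentiable_on_def by (elim conjE exE)
  obtain a' b' z' d' where
    x': "continuous_on {t0..t1} (\<lambda>t. snd (x t))" "(\<lambda>t. snd (x t)) ` {t0..t1} \<subseteq> U2"
    and ab': "a' < t0" "t1 < b'" and eq': "\<forall>t\<in>{t0..t1}. z' t = snd (x t)"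
    and d': "\<forall>t\<in>{a'<..<b'}. (z' has_vector_derivative d' t) (at t)" "continuous_on {a'<..<b'} d'"
    using C1(2) unfolding C1_curve_def C1_differentiable_on_def by (elim conjE exE)
  let ?a = "max a a'" and ?b = "min b b'"
  have sub: "{?a<..<?b} \<subseteq> {a<..<b}" "{?a<..<?b} \<subseteq> {a'<..<b'}"
    by auto
  have "(\<lambda>t. (z t, z' t)) C1_differentiable_on {?a<..<?b}"
    unfolding C1_differentiable_on_def
  proof (intro exI conjI ballI)
    show "((\<lambda>t. (z t, z' t)) has_vector_derivative (d t, d' t)) (at t)" if "t \<in> {?a<..<?b}" for t
      using d(1) d'(1) sub that by (intro has_vector_derivative_Pair) auto
    show "continuous_on {?a<..<?b} (\<lambda>t. (d t, d' t))"
      by (intro continuous_on_Pair continuous_on_subset[OF d(2)] continuous_on_subset[OF d'(2)] sub)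
  qed
  then show "C1_curve t0 t1 (U1 \<times> U2) x"
    unfolding C1_curve_def using x ab eq x' ab' eq'
    by (intro conjI exI[of _ ?a] exI[of _ ?b] exI[of _ "\<lambda>t. (z t, z' t)"])
      (auto simp: continuous_on_prod_iff[of _ x] image_subset_iff mem_Times_iff)
qed

text \<open>The derivative of the extension restricts to the interval and supplies the one-sided
  derivatives at its ends.\<close>

lemma C1_curve_has_vector_derivative:
  assumes "C1_curve t0 t1 U x" "t0 < t1"
  obtains d where "continuous_on {t0..t1} d"
    "\<forall>t\<in>{t0..t1}. (x has_vector_derivative d t) (at t within {t0..t1})"
proof -
  obtain a b z d where ab: "a < t0" "t1 < b" and eq: "\<forall>t\<in>{t0..t1}. z t = x t"
    and d: "\<forall>t\<in>{a<..<b}. (z has_vector_derivative d t) (at t)" "continuous_on {a<..<b} d"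
    using assms(1) unfolding C1_curve_def C1_differentiable_on_def by (elim conjE exE)
  show ?thesis
  proof
    show "continuous_on {t0..t1} d"
      using d(2) by (rule continuous_on_subset) (use ab in auto)
    show "\<forall>t\<in>{t0..t1}. (x has_vector_derivative d t) (at t within {t0..t1})"
    proof
      fix t assume t: "t \<in> {t0..t1}"
      have "(z has_vector_derivative d t) (at t within {t0..t1})"
        using d(1) ab t by (simp add: has_vector_derivative_at_within)
      then show "(x has_vector_derivative d t) (at t within {t0..t1})"
        by (rule has_vector_derivative_transform[OF t, rotated]) (use eq in simp)
    qed
  qed
qed

text \<open>Every point of a nondegenerate interval is a limit point of it, so derivatives within
  the interval are unique, one-sided ones included.\<close>

lemma vector_derivative_within_Icc:
  assumes "a < b" "t \<in> {a..b::real}" "(f has_vector_derivative d) (at t within {a..b})"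
  shows "vector_derivative f (at t within {a..b}) = d"
  using assms by (intro vector_derivative_within) (simp_all add: trivial_limit_within islimpt_Icc)

lemma vector_derivative_prod:
  assumes "C1_curve t0 t1 U x" "t0 < t1" "t \<in> {t0..t1}"
  shows "fst (vector_derivative x (at t within {t0..t1})) =
      vector_derivative (\<lambda>t. fst (x t)) (at t within {t0..t1})"
    and "snd (vector_derivative x (at t within {t0..t1})) =
      vector_derivative (\<lambda>t. snd (x t)) (at t within {t0..t1})"
proof -
  obtain d where "continuous_on {t0..t1} d"
    "\<forall>t\<in>{t0..t1}. (x has_vector_derivative d t) (at t within {t0..t1})"
    using C1_curve_has_vector_derivative[OF assms(1,2)] .
  note d = bspec[OF this(2) assms(3)]
  note unique = vector_derivative_within_Icc[OF assms(2,3)]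
  show "fst (vector_derivative x (at t within {t0..t1})) =
      vector_derivative (\<lambda>t. fst (x t)) (at t within {t0..t1})"
    using unique[OF d] unique[OF bounded_linear.has_vector_derivative[OF bounded_linear_fst d]] by simp
  show "snd (vector_derivative x (at t within {t0..t1})) =
      vector_derivative (\<lambda>t. snd (x t)) (at t within {t0..t1})"
    using unique[OF d] unique[OF bounded_linear.has_vector_derivative[OF bounded_linear_snd d]] by simp
qed

lemma continuous_on_vector_derivative:
  assumes "C1_curve t0 t1 U x" "t0 < t1"
  shows "continuous_on {t0..t1} (\<lambda>t. vector_derivative x (at t within {t0..t1}))"
proof -
  obtain d where d: "continuous_on {t0..t1} d"
    "\<forall>t\<in>{t0..t1}. (x has_vector_derivative d t) (at t within {t0..t1})"
    using C1_curve_has_vector_derivative[OF assms] .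
  have "d t = vector_derivative x (at t within {t0..t1})" if "t \<in> {t0..t1}" for t
    using vector_derivative_within_Icc[OF assms(2) that bspec[OF d(2) that]] by simp
  then show ?thesis
    using d(1) by (rule continuous_on_eq[rotated])
qed

section \<open>Interconnection of behaviours\<close>

lemma continuous_on_Pair_iff:
  "continuous_on S (\<lambda>t. (f t, g t)) \<longleftrightarrow> continuous_on S f \<and> continuous_on S g"
  using continuous_on_prod_iff[of S "\<lambda>t. (f t, g t)"] by simp

lemma classical_behaviour_iff:
  "(x, f, y, e, u) \<in> classical_behaviour U D R H t0 t1 \<longleftrightarrow>
     C1_curve t0 t1 U x \<and>
     continuous_on {t0..t1} f \<and> continuous_on {t0..t1} y \<and>
     continuous_on {t0..t1} e \<and> continuous_on {t0..t1} u \<and>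
     (\<forall>t\<in>{t0..t1}.
        ((vector_derivative x (at t within {t0..t1}), f t, - y t),
         (gradient H (x t), e t, u t)) \<in> D (x t)) \<and>
     (\<forall>t\<in>{t0..t1}. (f t, e t) \<in> R (x t))"
  unfolding classical_behaviour_def by (simp add: ball_conj_distrib)

lemma weak_behaviour_iff:
  "(x, f, y, e, u) \<in> weak_behaviour U D R H t0 t1 \<longleftrightarrow>
     continuous_on {t0..t1} x \<and> x ` {t0..t1} \<subseteq> U \<and>
     L1_curve t0 t1 f \<and> L1_curve t0 t1 y \<and> L1_curve t0 t1 e \<and> L1_curve t0 t1 u \<and>
     (\<exists>v. weak_derivative t0 t1 x v \<and>
        weakly_in sym_pairing t0 t1 D x
          (\<lambda>t. ((v t, f t, - y t), (gradient H (x t), e t, u t)))) \<and>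
     weakly_in symp_pairing t0 t1 R x (\<lambda>t. (f t, e t))"
  unfolding weak_behaviour_def by simp

lemma behaviour_interconnect_iff:
  "(x, f, y, e, u) \<in> behaviour_interconnect B1 Dint B2 t0 t1 \<longleftrightarrow>
     (\<exists>yb1 yb2 ub1 ub2.
       (\<forall>t\<in>{t0..t1}. ((yb1 t, yb2 t), (ub1 t, ub2 t)) \<in> Dint (x t)) \<and>
       (\<lambda>t. fst (x t), \<lambda>t. fst (f t), \<lambda>t. (fst (y t), - yb1 t),
        \<lambda>t. fst (e t), \<lambda>t. (fst (u t), ub1 t)) \<in> B1 t0 t1 \<and>
       (\<lambda>t. snd (x t), \<lambda>t. snd (f t), \<lambda>t. (snd (y t), - yb2 t),
        \<lambda>t. snd (e t), \<lambda>t. (snd (u t), ub2 t)) \<in> B2 t0 t1)"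
  unfolding behaviour_interconnect_def by simp

text \<open>Here the sign conventions meet: a subsystem has output \<open>- yb\<close> on its
  interconnection port, and outputs enter the structure negated, so the port flow of
  \<open>w\<close> appears with its own sign.\<close>

lemma glue_mem_iff:
  "glue ((v, f, - y), (g, e, u)) w \<in> A \<times> B \<longleftrightarrow>
     ((fst v, fst f, - (fst y, - fst (fst w))), (fst g, fst e, (fst u, fst (snd w)))) \<in> A \<and>
     ((snd v, snd f, - (snd y, - snd (fst w))), (snd g, snd e, (snd u, snd (snd w)))) \<in> B"
  by (cases w) simp

text \<open>Makes the padding of test curves by zero admissible.\<close>

lemma lagrangian_subbundle_zero:
  assumes "lagrangian_subbundle U R" "x \<in> U"
  shows "0 \<in> R x"
proof -
  obtain S where "R x = span S"
    using assms unfolding lagrangian_subbundle_def smooth_subbundle_def by metis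
  then show ?thesis
    using span_zero by simp
qed

section \<open>Interconnection of curves over fixed fibres\<close>

context
  fixes U1 :: "'n1::fd_inner set" and U2 :: "'n2::fd_inner set"
    and D1 :: "'n1 \<Rightarrow> (('n1 \<times> 'r1::fd_inner \<times> 'ep1::fd_inner \<times> 'ip1::fd_inner) \<times>
                      ('n1 \<times> 'r1 \<times> 'ep1 \<times> 'ip1)) set"
    and D2 :: "'n2 \<Rightarrow> (('n2 \<times> 'r2::fd_inner \<times> 'ep2::fd_inner \<times> 'ip2::fd_inner) \<times>
                      ('n2 \<times> 'r2 \<times> 'ep2 \<times> 'ip2)) set"
    and Dint :: "'n1 \<times> 'n2 \<Rightarrow> (('ip1 \<times> 'ip2) \<times> ('ip1 \<times> 'ip2)) set"
    and H1 :: "'n1 \<Rightarrow> real" and H2 :: "'n2 \<Rightarrow> real" and t0 t1 :: real and A B W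
  assumes smooth: "smooth_on U1 H1" "smooth_on U2 H2"
    and D1: "\<And>x. x \<in> U1 \<Longrightarrow> D1 x = A" and D2: "\<And>x. x \<in> U2 \<Longrightarrow> D2 x = B"
    and Dint: "\<And>x. x \<in> U1 \<times> U2 \<Longrightarrow> Dint x = W"
    and subspaces: "subspace A" "subspace B" "subspace W"
begin

lemma interconnect_constant:
  "x \<in> U1 \<times> U2 \<Longrightarrow> interconnect D1 Dint D2 x = interconnect_fibre A W B"
  unfolding interconnect_eq_fibre using D1 D2 Dint by (simp add: mem_Times_iff)

lemma continuous_on_gradient_curve:
  assumes "continuous_on {t0..t1} x" "x ` {t0..t1} \<subseteq> U1 \<times> U2"
  shows "continuous_on {t0..t1} (\<lambda>t. gradient H1 (fst (x t)))"
    and "continuous_on {t0..t1} (\<lambda>t. gradient H2 (snd (x t)))"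
    and "continuous_on {t0..t1} (\<lambda>t. gradient (\<lambda>(x1, x2). H1 x1 + H2 x2) (x t))"
proof -
  show 1: "continuous_on {t0..t1} (\<lambda>t. gradient H1 (fst (x t)))"
    using assms by (intro continuous_on_compose2[OF continuous_on_gradient[OF smooth(1)]]
        continuous_on_fst) (auto simp: image_subset_iff mem_Times_iff)
  show 2: "continuous_on {t0..t1} (\<lambda>t. gradient H2 (snd (x t)))"
    using assms by (intro continuous_on_compose2[OF continuous_on_gradient[OF smooth(2)]]
        continuous_on_snd) (auto simp: image_subset_iff mem_Times_iff)
  have "continuous_on {t0..t1} (\<lambda>t. (gradient H1 (fst (x t)), gradient H2 (snd (x t))))"
    using 1 2 by (rule continuous_on_Pair)
  then show "continuous_on {t0..t1} (\<lambda>t. gradient (\<lambda>(x1, x2). H1 x1 + H2 x2) (x t))"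
    by (rule continuous_on_eq)
      (use assms(2) in \<open>simp add: gradient_add_prod[OF smooth] image_subset_iff\<close>)
qed

text \<open>All relations hold at every time, so gluing translates one side into the other; the one
  analytic point is a continuous choice of interconnection variables when a composed curve is
  split.\<close>

lemma classical_interconnection:
  assumes "t0 < t1"
  shows "behaviour_interconnect (classical_behaviour U1 D1 R1 H1) Dint
           (classical_behaviour U2 D2 R2 H2) t0 t1 =
         classical_behaviour (U1 \<times> U2) (interconnect D1 Dint D2) (prod_bundle R1 R2)
           (\<lambda>(x1, x2). H1 x1 + H2 x2) t0 t1"
    (is "?L = ?R")
proof (rule set_eqI)
  fix z :: "(real \<Rightarrow> 'n1 \<times> 'n2) \<times> (real \<Rightarrow> 'r1 \<times> 'r2) \<times> (real \<Rightarrow> 'ep1 \<times> 'ep2) \<times>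
    (real \<Rightarrow> 'r1 \<times> 'r2) \<times> (real \<Rightarrow> 'ep1 \<times> 'ep2)"
  obtain x f y e u where z: "z = (x, f, y, e, u)"
    by (rule prod_cases5)
  let ?v = "\<lambda>t. vector_derivative x (at t within {t0..t1})"
  let ?v1 = "\<lambda>t. vector_derivative (\<lambda>t. fst (x t)) (at t within {t0..t1})"
  let ?v2 = "\<lambda>t. vector_derivative (\<lambda>t. snd (x t)) (at t within {t0..t1})"
  let ?c = "\<lambda>t. ((?v t, f t, - y t), (gradient (\<lambda>(x1, x2). H1 x1 + H2 x2) (x t), e t, u t))"
  let ?c1 = "\<lambda>w t. ((?v1 t, fst (f t), - (fst (y t), - fst (fst (w t)))),
      (gradient H1 (fst (x t)), fst (e t), (fst (u t), fst (snd (w t)))))"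
  let ?c2 = "\<lambda>w t. ((?v2 t, snd (f t), - (snd (y t), - snd (fst (w t)))),
      (gradient H2 (snd (x t)), snd (e t), (snd (u t), snd (snd (w t)))))"
  have mem: "x t \<in> U1 \<times> U2" if "C1_curve t0 t1 (U1 \<times> U2) x" "t \<in> {t0..t1}" for t
    using that unfolding C1_curve_def by blast
  have glue: "glue (?c t) (w t) \<in> A \<times> B \<longleftrightarrow> ?c1 w t \<in> D1 (fst (x t)) \<and> ?c2 w t \<in> D2 (snd (x t))"
    if C1: "C1_curve t0 t1 (U1 \<times> U2) x" and t: "t \<in> {t0..t1}" for t w
  proof -
    have "D1 (fst (x t)) = A" "D2 (snd (x t)) = B"
      using D1 D2 mem[OF C1 t] by (simp_all add: mem_Times_iff)
    then show ?thesis
      unfolding glue_mem_iff vector_derivative_prod[OF C1 assms t]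
        gradient_add_prod[OF smooth mem[OF C1 t]] by simp
  qed
  have "z \<in> ?R" if L: "z \<in> ?L"
  proof -
    obtain yb1 yb2 ub1 ub2 where
      int: "\<forall>t\<in>{t0..t1}. ((yb1 t, yb2 t), (ub1 t, ub2 t)) \<in> Dint (x t)"
      and B1: "(\<lambda>t. fst (x t), \<lambda>t. fst (f t), \<lambda>t. (fst (y t), - yb1 t),
        \<lambda>t. fst (e t), \<lambda>t. (fst (u t), ub1 t)) \<in> classical_behaviour U1 D1 R1 H1 t0 t1"
      and B2: "(\<lambda>t. snd (x t), \<lambda>t. snd (f t), \<lambda>t. (snd (y t), - yb2 t),
        \<lambda>t. snd (e t), \<lambda>t. (snd (u t), ub2 t)) \<in> classical_behaviour U2 D2 R2 H2 t0 t1"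
      using L unfolding z behaviour_interconnect_iff by (elim exE conjE)
    note B1 = B1[unfolded classical_behaviour_iff continuous_on_Pair_iff]
    note B2 = B2[unfolded classical_behaviour_iff continuous_on_Pair_iff]
    have C1: "C1_curve t0 t1 (U1 \<times> U2) x"
      unfolding C1_curve_prod_iff using B1 B2 by (intro conjI) simp_all
    define w where "w t = ((yb1 t, yb2 t), (ub1 t, ub2 t))" for t
    have c12: "\<forall>t\<in>{t0..t1}. ?c1 w t \<in> D1 (fst (x t))" "\<forall>t\<in>{t0..t1}. ?c2 w t \<in> D2 (snd (x t))"
      using B1 B2 unfolding w_def fst_conv snd_conv by - (elim conjE; assumption)+
    have "?c t \<in> interconnect D1 Dint D2 (x t)" if t: "t \<in> {t0..t1}" for t
      unfolding interconnect_constant[OF mem[OF C1 t]] interconnect_fibre_def mem_Collect_eq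
    proof
      show "w t \<in> W"
        using bspec[OF int t] unfolding Dint[OF mem[OF C1 t]] w_def .
      show "glue (?c t) (w t) \<in> A \<times> B"
        unfolding glue[OF C1 t] using c12 t by (intro conjI) (rule bspec; assumption)+
    qed
    then show ?thesis
      unfolding z classical_behaviour_iff continuous_on_prod_iff[of _ f] continuous_on_prod_iff[of _ y]
        continuous_on_prod_iff[of _ e] continuous_on_prod_iff[of _ u] prod_bundle_iff
      using B1 B2 C1 by (intro conjI ballI) simp_all
  qed
  moreover have "z \<in> ?L" if R: "z \<in> ?R"
  proof -
    note R = R[unfolded z classical_behaviour_iff prod_bundle_iff]
    then have C1: "C1_curve t0 t1 (U1 \<times> U2) x"
      by simp
    have x: "continuous_on {t0..t1} x" "x ` {t0..t1} \<subseteq> U1 \<times> U2"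
      using C1 unfolding C1_curve_def by simp_all
    obtain h where h: "linear h" "\<And>c. h c \<in> W"
      "\<And>c. c \<in> interconnect_fibre A W B \<Longrightarrow> glue c (h c) \<in> A \<times> B"
      using interconnect_fibre_linear_selection[OF subspaces] by metis
    \<comment> \<open>A fixed linear function of derivative, gradient and port variables, all
      continuous; an arbitrary pointwise choice need not be continuous.\<close>
    define w where "w t = h (?c t)" for t
    have "continuous_on {t0..t1} w"
      unfolding w_def using R
      by (intro continuous_on_linear[OF h(1)] continuous_on_Pair continuous_on_minus
          continuous_on_vector_derivative[OF C1 assms] continuous_on_gradient_curve x) simp_all
    then have w: "continuous_on {t0..t1} (\<lambda>t. fst (fst (w t)))" "continuous_on {t0..t1} (\<lambda>t. snd (fst (w t)))"
      "continuous_on {t0..t1} (\<lambda>t. fst (snd (w t)))" "continuous_on {t0..t1} (\<lambda>t. snd (snd (w t)))"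
      by (intro continuous_on_fst continuous_on_snd; assumption)+
    have c: "\<forall>t\<in>{t0..t1}. ?c t \<in> interconnect D1 Dint D2 (x t)"
      using R by (elim conjE)
    have "glue (?c t) (w t) \<in> A \<times> B" if t: "t \<in> {t0..t1}" for t
      unfolding w_def by (rule h(3)[OF bspec[OF c t, unfolded interconnect_constant[OF mem[OF C1 t]]]])
    then have c12: "\<forall>t\<in>{t0..t1}. ?c1 w t \<in> D1 (fst (x t))" "\<forall>t\<in>{t0..t1}. ?c2 w t \<in> D2 (snd (x t))"
      using glue[OF C1, of _ w] by simp_all
    note cont = R[unfolded fst_conv snd_conv continuous_on_prod_iff[of _ f] continuous_on_prod_iff[of _ y]
        continuous_on_prod_iff[of _ e] continuous_on_prod_iff[of _ u] C1_curve_prod_iff ball_conj_distrib]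
    show ?thesis
      unfolding z behaviour_interconnect_iff
    proof (intro exI conjI ballI)
      show "((fst (fst (w t)), snd (fst (w t))), (fst (snd (w t)), snd (snd (w t)))) \<in> Dint (x t)"
        if t: "t \<in> {t0..t1}" for t
        using h(2) Dint[OF mem[OF C1 t]] by (simp add: w_def)
      show "(\<lambda>t. fst (x t), \<lambda>t. fst (f t), \<lambda>t. (fst (y t), - fst (fst (w t))),
        \<lambda>t. fst (e t), \<lambda>t. (fst (u t), fst (snd (w t)))) \<in> classical_behaviour U1 D1 R1 H1 t0 t1"
        unfolding classical_behaviour_iff continuous_on_Pair_iff
        using cont w c12(1) by (elim conjE) (intro conjI continuous_on_minus)
      show "(\<lambda>t. snd (x t), \<lambda>t. snd (f t), \<lambda>t. (snd (y t), - snd (fst (w t))),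
        \<lambda>t. snd (e t), \<lambda>t. (snd (u t), snd (snd (w t)))) \<in> classical_behaviour U2 D2 R2 H2 t0 t1"
        unfolding classical_behaviour_iff continuous_on_Pair_iff
        using cont w c12(2) by (elim conjE) (intro conjI continuous_on_minus)
    qed
  qed
  ultimately show "z \<in> ?L \<longleftrightarrow> z \<in> ?R" by (rule iffI)
qed

text \<open>Both inclusions pass through almost everywhere membership. Composing uses coisotropy of
  the two subsystem fibres and isotropy of the composed one; splitting uses coisotropy of the
  composed fibre and isotropy of the other two.\<close>

lemma weak_interconnection:
  assumes coiso: "coisotropic A" "coisotropic B" "coisotropic W"
    and iso: "\<And>p q. p \<in> A \<Longrightarrow> q \<in> A \<Longrightarrow> sym_pairing p q = 0"
      "\<And>p q. p \<in> B \<Longrightarrow> q \<in> B \<Longrightarrow> sym_pairing p q = 0"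
      "\<And>p q. p \<in> W \<Longrightarrow> q \<in> W \<Longrightarrow> sym_pairing p q = 0"
    and zero: "\<And>x. x \<in> U1 \<Longrightarrow> 0 \<in> R1 x" "\<And>x. x \<in> U2 \<Longrightarrow> 0 \<in> R2 x"
  shows "behaviour_interconnect (weak_behaviour U1 D1 R1 H1) Dint
           (weak_behaviour U2 D2 R2 H2) t0 t1 =
         weak_behaviour (U1 \<times> U2) (interconnect D1 Dint D2) (prod_bundle R1 R2)
           (\<lambda>(x1, x2). H1 x1 + H2 x2) t0 t1"
    (is "?L = ?R")
proof (rule set_eqI)
  fix z :: "(real \<Rightarrow> 'n1 \<times> 'n2) \<times> (real \<Rightarrow> 'r1 \<times> 'r2) \<times> (real \<Rightarrow> 'ep1 \<times> 'ep2) \<times>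
    (real \<Rightarrow> 'r1 \<times> 'r2) \<times> (real \<Rightarrow> 'ep1 \<times> 'ep2)"
  obtain x f y e u where z: "z = (x, f, y, e, u)"
    by (rule prod_cases5)
  let ?M = "lebesgue_on {t0..t1}"
  let ?c = "\<lambda>v t. ((v t, f t, - y t), (gradient (\<lambda>(x1, x2). H1 x1 + H2 x2) (x t), e t, u t))"
  let ?c1 = "\<lambda>v w t. ((fst (v t), fst (f t), - (fst (y t), - fst (fst (w t)))),
      (gradient H1 (fst (x t)), fst (e t), (fst (u t), fst (snd (w t)))))"
  let ?c2 = "\<lambda>v w t. ((snd (v t), snd (f t), - (snd (y t), - snd (fst (w t)))),
      (gradient H2 (snd (x t)), snd (e t), (snd (u t), snd (snd (w t)))))"
  have space: "AE t in ?M. t \<in> {t0..t1}"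
    using AE_space[of ?M] by simp
  have resistive: "weakly_in symp_pairing t0 t1 (prod_bundle R1 R2) x (\<lambda>t. (f t, e t)) \<longleftrightarrow>
     weakly_in symp_pairing t0 t1 R1 (\<lambda>t. fst (x t)) (\<lambda>t. (fst (f t), fst (e t))) \<and>
     weakly_in symp_pairing t0 t1 R2 (\<lambda>t. snd (x t)) (\<lambda>t. (snd (f t), snd (e t)))"
    if "x ` {t0..t1} \<subseteq> U1 \<times> U2" "L1_curve t0 t1 f" "L1_curve t0 t1 e"
    using that(2,3)
  proof (rule weakly_in_prod_bundle)
    show "0 \<in> R1 (fst (x t))" "0 \<in> R2 (snd (x t))" if "t \<in> {t0..t1}" for t
      using zero \<open>x ` {t0..t1} \<subseteq> U1 \<times> U2\<close> that by (simp_all add: image_subset_iff mem_Times_iff)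
  qed
  have glue: "glue (?c v t) (w t) \<in> A \<times> B \<longleftrightarrow> ?c1 v w t \<in> A \<and> ?c2 v w t \<in> B"
    if "x t \<in> U1 \<times> U2" for v w t
    unfolding glue_mem_iff gradient_add_prod[OF smooth that] by simp
  have "z \<in> ?R" if L: "z \<in> ?L"
  proof -
    obtain yb1 yb2 ub1 ub2 where
      int: "\<forall>t\<in>{t0..t1}. ((yb1 t, yb2 t), (ub1 t, ub2 t)) \<in> Dint (x t)"
      and B1: "(\<lambda>t. fst (x t), \<lambda>t. fst (f t), \<lambda>t. (fst (y t), - yb1 t),
        \<lambda>t. fst (e t), \<lambda>t. (fst (u t), ub1 t)) \<in> weak_behaviour U1 D1 R1 H1 t0 t1"
      and B2: "(\<lambda>t. snd (x t), \<lambda>t. snd (f t), \<lambda>t. (snd (y t), - yb2 t),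
        \<lambda>t. snd (e t), \<lambda>t. (snd (u t), ub2 t)) \<in> weak_behaviour U2 D2 R2 H2 t0 t1"
      using L unfolding z behaviour_interconnect_iff by (elim exE conjE)
    obtain v1 where B1: "continuous_on {t0..t1} (\<lambda>t. fst (x t))" "(\<lambda>t. fst (x t)) ` {t0..t1} \<subseteq> U1"
        "L1_curve t0 t1 (\<lambda>t. fst (f t))" "L1_curve t0 t1 (\<lambda>t. (fst (y t), - yb1 t))"
        "L1_curve t0 t1 (\<lambda>t. fst (e t))" "L1_curve t0 t1 (\<lambda>t. (fst (u t), ub1 t))"
        "weakly_in symp_pairing t0 t1 R1 (\<lambda>t. fst (x t)) (\<lambda>t. (fst (f t), fst (e t)))"
      and v1: "weak_derivative t0 t1 (\<lambda>t. fst (x t)) v1"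
        "weakly_in sym_pairing t0 t1 D1 (\<lambda>t. fst (x t)) (\<lambda>t. ((v1 t, fst (f t), - (fst (y t), - yb1 t)),
          (gradient H1 (fst (x t)), fst (e t), (fst (u t), ub1 t))))"
      using B1 unfolding weak_behaviour_iff by (elim exE conjE)
    obtain v2 where B2: "continuous_on {t0..t1} (\<lambda>t. snd (x t))" "(\<lambda>t. snd (x t)) ` {t0..t1} \<subseteq> U2"
        "L1_curve t0 t1 (\<lambda>t. snd (f t))" "L1_curve t0 t1 (\<lambda>t. (snd (y t), - yb2 t))"
        "L1_curve t0 t1 (\<lambda>t. snd (e t))" "L1_curve t0 t1 (\<lambda>t. (snd (u t), ub2 t))"
        "weakly_in symp_pairing t0 t1 R2 (\<lambda>t. snd (x t)) (\<lambda>t. (snd (f t), snd (e t)))"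
      and v2: "weak_derivative t0 t1 (\<lambda>t. snd (x t)) v2"
        "weakly_in sym_pairing t0 t1 D2 (\<lambda>t. snd (x t)) (\<lambda>t. ((v2 t, snd (f t), - (snd (y t), - yb2 t)),
          (gradient H2 (snd (x t)), snd (e t), (snd (u t), ub2 t))))"
      using B2 unfolding weak_behaviour_iff by (elim exE conjE)
    \<comment> \<open>The two subsystems come with separate weak derivatives; their pair is the
      witness for the composed curve.\<close>
    define v where "v t = (v1 t, v2 t)" for t
    define w where "w t = ((yb1 t, yb2 t), (ub1 t, ub2 t))" for t
    have x: "continuous_on {t0..t1} x" "x ` {t0..t1} \<subseteq> U1 \<times> U2"
      using B1(1,2) B2(1,2) by (simp_all add: continuous_on_prod_iff[of _ x] image_subset_iff mem_Times_iff)
    have deriv: "weak_derivative t0 t1 x v"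
      unfolding weak_derivative_prod_iff[OF x(1)] v_def using v1(1) v2(1) by simp
    have L1: "L1_curve t0 t1 f" "L1_curve t0 t1 y" "L1_curve t0 t1 e" "L1_curve t0 t1 u"
      using B1 B2 by (simp_all add: L1_curve_prod_iff[of _ _ f] L1_curve_prod_iff[of _ _ y]
          L1_curve_prod_iff[of _ _ e] L1_curve_prod_iff[of _ _ u] L1_curve_Pair_iff)
    have "AE t in ?M. ?c1 v w t \<in> A"
    proof (rule weakly_in_imp_AE[OF subspaces(1) coiso(1), where E = D1 and x = "\<lambda>t. fst (x t)"])
      show "D1 (fst (x t)) = A" if "t \<in> {t0..t1}" for t
        using D1 x(2) that by (simp add: image_subset_iff mem_Times_iff)
      \<comment> \<open>Integrability of the gradient component comes from its continuity along the
        base curve.\<close>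
      show "L1_curve t0 t1 (?c1 v w)"
        using B1 v1(1) L1_curve_continuous[OF continuous_on_gradient_curve(1)[OF x]]
        unfolding v_def w_def weak_derivative_def by (simp add: L1_curve_Pair_iff L1_curve_minus_iff)
      show "weakly_in sym_pairing t0 t1 D1 (\<lambda>t. fst (x t)) (?c1 v w)"
        using v1(2) by (simp add: v_def w_def)
    qed
    moreover have "AE t in ?M. ?c2 v w t \<in> B"
    proof (rule weakly_in_imp_AE[OF subspaces(2) coiso(2), where E = D2 and x = "\<lambda>t. snd (x t)"])
      show "D2 (snd (x t)) = B" if "t \<in> {t0..t1}" for t
        using D2 x(2) that by (simp add: image_subset_iff mem_Times_iff)
      show "L1_curve t0 t1 (?c2 v w)"
        using B2 v2(1) L1_curve_continuous[OF continuous_on_gradient_curve(2)[OF x]]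
        unfolding v_def w_def weak_derivative_def by (simp add: L1_curve_Pair_iff L1_curve_minus_iff)
      show "weakly_in sym_pairing t0 t1 D2 (\<lambda>t. snd (x t)) (?c2 v w)"
        using v2(2) by (simp add: v_def w_def)
    qed
    \<comment> \<open>Two null sets are discarded at once; membership of \<open>w t\<close> in
      \<open>W\<close> holds at every time of the interval and adds none.\<close>
    ultimately have "AE t in ?M. ?c v t \<in> interconnect_fibre A W B"
      using space
    proof eventually_elim
      case (elim t)
      then have xt: "x t \<in> U1 \<times> U2"
        using x(2) by blast
      have "w t \<in> W"
        using bspec[OF int elim(3)] unfolding Dint[OF xt] w_def .
      moreover have "glue (?c v t) (w t) \<in> A \<times> B"
        unfolding glue[OF xt] using elim(1,2) by (rule conjI)
      ultimately show ?case
        unfolding interconnect_fibre_def mem_Collect_eq by (rule bexI[rotated])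
    qed
    then have "weakly_in sym_pairing t0 t1 (interconnect D1 Dint D2) x (?c v)"
    proof (rule AE_imp_weakly_in[OF interconnect_fibre_isotropic[OF iso], rotated -1])
      show "interconnect D1 Dint D2 (x t) = interconnect_fibre A W B" if "t \<in> {t0..t1}" for t
        using x(2) that by (intro interconnect_constant) blast
    qed
    then show ?thesis
      unfolding z weak_behaviour_iff resistive[OF x(2) L1(1,3)]
      using x L1 deriv B1(7) B2(7) by (intro conjI exI[of _ v])
  qed
  moreover have "z \<in> ?L" if R: "z \<in> ?R"
  proof -
    obtain v where x: "continuous_on {t0..t1} x" "x ` {t0..t1} \<subseteq> U1 \<times> U2"
      and L1: "L1_curve t0 t1 f" "L1_curve t0 t1 y" "L1_curve t0 t1 e" "L1_curve t0 t1 u"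
      and v: "weak_derivative t0 t1 x v"
        "weakly_in sym_pairing t0 t1 (interconnect D1 Dint D2) x (?c v)"
      and res: "weakly_in symp_pairing t0 t1 (prod_bundle R1 R2) x (\<lambda>t. (f t, e t))"
      using R unfolding z weak_behaviour_iff by (elim exE conjE)
    have xt: "x t \<in> U1 \<times> U2" if "t \<in> {t0..t1}" for t
      using x(2) that by blast
    have c: "L1_curve t0 t1 (?c v)"
      using L1 v(1) L1_curve_continuous[OF continuous_on_gradient_curve(3)[OF x]]
      unfolding weak_derivative_def by (simp add: L1_curve_Pair_iff L1_curve_minus_iff)
    obtain h where h: "linear h" "\<And>c. h c \<in> W"
      "\<And>c. c \<in> interconnect_fibre A W B \<Longrightarrow> glue c (h c) \<in> A \<times> B"
      using interconnect_fibre_linear_selection[OF subspaces] by metis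
    define w where "w t = h (?c v t)" for t
    have "L1_curve t0 t1 w"
      unfolding w_def by (rule L1_curve_bounded_linear[OF linear_imp_bounded_linear[OF h(1)] c])
    then have w: "L1_curve t0 t1 (\<lambda>t. fst (fst (w t)))" "L1_curve t0 t1 (\<lambda>t. snd (fst (w t)))"
      "L1_curve t0 t1 (\<lambda>t. fst (snd (w t)))" "L1_curve t0 t1 (\<lambda>t. snd (snd (w t)))"
      by (intro L1_curve_bounded_linear[OF bounded_linear_fst]
          L1_curve_bounded_linear[OF bounded_linear_snd]; assumption)+
    have "AE t in ?M. ?c v t \<in> interconnect_fibre A W B"
      by (rule weakly_in_imp_AE[OF subspace_interconnect_fibre[OF subspaces]
            interconnect_fibre_coisotropic[OF subspaces coiso] _ c v(2)])
        (rule interconnect_constant[OF xt])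
    with space have AE: "AE t in ?M. ?c1 v w t \<in> A \<and> ?c2 v w t \<in> B"
    proof eventually_elim
      case (elim t)
      have "glue (?c v t) (w t) \<in> A \<times> B"
        unfolding w_def by (rule h(3)[OF elim(2)])
      then show ?case
        unfolding glue[OF xt[OF elim(1)]] .
    qed
    have D1_weak: "weakly_in sym_pairing t0 t1 D1 (\<lambda>t. fst (x t)) (?c1 v w)"
    proof (rule AE_imp_weakly_in[OF iso(1)])
      show "D1 (fst (x t)) = A" if "t \<in> {t0..t1}" for t
        using D1 xt[OF that] by (simp add: mem_Times_iff)
      show "AE t in ?M. ?c1 v w t \<in> A"
        using AE by eventually_elim (rule conjunct1)
    qed
    have D2_weak: "weakly_in sym_pairing t0 t1 D2 (\<lambda>t. snd (x t)) (?c2 v w)"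
    proof (rule AE_imp_weakly_in[OF iso(2)])
      show "D2 (snd (x t)) = B" if "t \<in> {t0..t1}" for t
        using D2 xt[OF that] by (simp add: mem_Times_iff)
      show "AE t in ?M. ?c2 v w t \<in> B"
        using AE by eventually_elim (rule conjunct2)
    qed
    have L1s: "L1_curve t0 t1 (\<lambda>t. fst (f t))" "L1_curve t0 t1 (\<lambda>t. snd (f t))"
      "L1_curve t0 t1 (\<lambda>t. fst (y t))" "L1_curve t0 t1 (\<lambda>t. snd (y t))"
      "L1_curve t0 t1 (\<lambda>t. fst (e t))" "L1_curve t0 t1 (\<lambda>t. snd (e t))"
      "L1_curve t0 t1 (\<lambda>t. fst (u t))" "L1_curve t0 t1 (\<lambda>t. snd (u t))"
      by (intro L1_curve_bounded_linear[OF bounded_linear_fst]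
          L1_curve_bounded_linear[OF bounded_linear_snd] L1)+
    note xs = x(1)[unfolded continuous_on_prod_iff[of _ x]]
    \<comment> \<open>The components of \<open>v\<close> are the weak derivatives of the subsystems,
      the same ones that enter \<open>?c1\<close> and \<open>?c2\<close>.\<close>
    note vs = v(1)[unfolded weak_derivative_prod_iff[OF x(1)]]
    note ress = res[unfolded resistive[OF x(2) L1(1,3)]]
    show ?thesis
      unfolding z behaviour_interconnect_iff
    proof (intro exI conjI ballI)
      show "((fst (fst (w t)), snd (fst (w t))), (fst (snd (w t)), snd (snd (w t)))) \<in> Dint (x t)"
        if "t \<in> {t0..t1}" for t
        using h(2) Dint[OF xt[OF that]] by (simp add: w_def)
      show "(\<lambda>t. fst (x t), \<lambda>t. fst (f t), \<lambda>t. (fst (y t), - fst (fst (w t))),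
        \<lambda>t. fst (e t), \<lambda>t. (fst (u t), fst (snd (w t)))) \<in> weak_behaviour U1 D1 R1 H1 t0 t1"
        unfolding weak_behaviour_iff L1_curve_Pair_iff L1_curve_minus_iff
        using xs L1s w vs D1_weak ress x(2)
        by (intro conjI exI[of _ "\<lambda>t. fst (v t)"]) (simp_all add: image_subset_iff mem_Times_iff)
      show "(\<lambda>t. snd (x t), \<lambda>t. snd (f t), \<lambda>t. (snd (y t), - snd (fst (w t))),
        \<lambda>t. snd (e t), \<lambda>t. (snd (u t), snd (snd (w t)))) \<in> weak_behaviour U2 D2 R2 H2 t0 t1"
        unfolding weak_behaviour_iff L1_curve_Pair_iff L1_curve_minus_iff
        using xs L1s w vs D2_weak ress x(2)
        by (intro conjI exI[of _ "\<lambda>t. snd (v t)"]) (simp_all add: image_subset_iff mem_Times_iff)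
    qed
  qed
  ultimately show "z \<in> ?L \<longleftrightarrow> z \<in> ?R" by (rule iffI)
qed

end

theorem proposition5p3:
  fixes U1 :: "'n1::fd_inner set" and U2 :: "'n2::fd_inner set"
    and D1 :: "'n1 \<Rightarrow> (('n1 \<times> 'r1::fd_inner \<times> 'ep1::fd_inner \<times> 'ip1::fd_inner) \<times>
                      ('n1 \<times> 'r1 \<times> 'ep1 \<times> 'ip1)) set"
    and D2 :: "'n2 \<Rightarrow> (('n2 \<times> 'r2::fd_inner \<times> 'ep2::fd_inner \<times> 'ip2::fd_inner) \<times>
                      ('n2 \<times> 'r2 \<times> 'ep2 \<times> 'ip2)) set"
    and R1 :: "'n1 \<Rightarrow> ('r1 \<times> 'r1) set" and R2 :: "'n2 \<Rightarrow> ('r2 \<times> 'r2) set"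
    and H1 :: "'n1 \<Rightarrow> real" and H2 :: "'n2 \<Rightarrow> real"
    and Dint :: "'n1 \<times> 'n2 \<Rightarrow> (('ip1 \<times> 'ip2) \<times> ('ip1 \<times> 'ip2)) set"
    and t0 t1 :: real
  assumes "open U1" "U1 \<noteq> {}" and "open U2" "U2 \<noteq> {}"
    and "dirac_structure U1 D1" "constant_bundle U1 D1"
    and "dirac_structure U2 D2" "constant_bundle U2 D2"
    and "lagrangian_subbundle U1 R1" and "lagrangian_subbundle U2 R2"
    and "smooth_on U1 H1" and "smooth_on U2 H2"
    and "dirac_structure (U1 \<times> U2) Dint" "constant_bundle (U1 \<times> U2) Dint"
    and "t0 < t1"
  shows "behaviour_interconnect (classical_behaviour U1 D1 R1 H1) Dint
           (classical_behaviour U2 D2 R2 H2) t0 t1 =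
         classical_behaviour (U1 \<times> U2) (interconnect D1 Dint D2) (prod_bundle R1 R2)
           (\<lambda>(x1, x2). H1 x1 + H2 x2) t0 t1 \<and>
         behaviour_interconnect (weak_behaviour U1 D1 R1 H1) Dint
           (weak_behaviour U2 D2 R2 H2) t0 t1 =
         weak_behaviour (U1 \<times> U2) (interconnect D1 Dint D2) (prod_bundle R1 R2)
           (\<lambda>(x1, x2). H1 x1 + H2 x2) t0 t1"
proof -
  obtain A where A: "subspace A" "\<forall>x\<in>U1. D1 x = A" "coisotropic A"
    "\<forall>p\<in>A. \<forall>q\<in>A. sym_pairing p q = 0"
    using dirac_constantE[OF assms(5,6,2)] .
  obtain B where B: "subspace B" "\<forall>x\<in>U2. D2 x = B" "coisotropic B"
    "\<forall>p\<in>B. \<forall>q\<in>B. sym_pairing p q = 0"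
    using dirac_constantE[OF assms(7,8,4)] .
  \<comment> \<open>The fibre of \<open>Dint\<close> is analysed over a point of the product
    base.\<close>
  have nonempty: "U1 \<times> U2 \<noteq> {}"
    using assms(2,4) by simp
  obtain W where W: "subspace W" "\<forall>x\<in>U1 \<times> U2. Dint x = W" "coisotropic W"
    "\<forall>p\<in>W. \<forall>q\<in>W. sym_pairing p q = 0"
    using dirac_constantE[OF assms(13,14) nonempty] .
  note const = assms(11,12) A(2)[rule_format] B(2)[rule_format] W(2)[rule_format] A(1) B(1) W(1)
  show ?thesis
    using classical_interconnection[OF const assms(15)]
      weak_interconnection[OF const A(3) B(3) W(3) A(4)[rule_format] B(4)[rule_format] W(4)[rule_format]
        lagrangian_subbundle_zero[OF assms(9)] lagrangian_subbundle_zero[OF assms(10)]]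
    by (rule conjI)
qed

end
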